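(* (a) For every $d \ge 1$, $\dfrac{W_n}{\ln\ln n} \to d-1$ in probability as $n \to \infty$. (b) If $d \ge 2$, then almost surely \[ \liminf_{n\to\infty} \frac{W_n}{\ln\ln n} = d-1 \quad\text{and}\quad \limsup_{n\to\infty} \frac{W_n}{\ln\ln n} = d; \] in particular $W_n = \Theta(\ln\ln n)$ almost surely.
   Context: Fix an integer $d \ge 1$. Let $X^{(1)}, X^{(2)}, \dots$ be i.i.d. random vectors in $\mathbb{R}^d$ with independent Exponential$(1)$ coordinates. For $x,y \in \mathbb{R}^d$ write $x \prec y$ if $x_j<y_j$ for all $j$, $x \le y$ if $x_j \le y_j$ for all $j$, and $x_+ := \sum_j x_j$. The record-setting region at time $n$ is $\mathrm{RS}_n := \{x \in \mathbb{R}^d : 0 \le x,\ x \not\prec X^{(i)} \text{ for all } 1 \le i \le n\}$, and its frontier $F_n$ is the topological boundary of $\mathrm{RS}_n$ relative to $[0,\infty)^d$. Define $F_n^- := \min\{x_+ : x \in F_n\}$, $F_n^+ := \max\{x_+ : x \in F_n\}$, and the width $W_n := F_n^+ - F_n^-$. *)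

theory Defs
  imports "HOL-Probability.Probability" "HOL-Library.Landau_Symbols"
begin

definition orthant :: "(real^'d) set" where
  "orthant = {x. \<forall>j. 0 \<le> x $ j}"

definition strictly_below :: "real^'d \<Rightarrow> real^'d \<Rightarrow> bool" where
  "strictly_below x y \<longleftrightarrow> (\<forall>j. x $ j < y $ j)"

definition coord_sum :: "real^'d \<Rightarrow> real" where
  "coord_sum x = (\<Sum>j\<in>UNIV. x $ j)"

definition record_region :: "(nat \<Rightarrow> real^'d) \<Rightarrow> nat \<Rightarrow> (real^'d) set" where
  "record_region xs n = {x \<in> orthant. \<forall>i\<in>{1..n}. \<not> strictly_below x (xs i)}"

definition record_frontier :: "(nat \<Rightarrow> real^'d) \<Rightarrow> nat \<Rightarrow> (real^'d) set" where
  "record_frontier xs n = (top_of_set orthant) frontier_of (record_region xs n)"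

definition frontier_min :: "(nat \<Rightarrow> real^'d) \<Rightarrow> nat \<Rightarrow> real" where
  "frontier_min xs n = Inf (coord_sum ` record_frontier xs n)"

definition frontier_max :: "(nat \<Rightarrow> real^'d) \<Rightarrow> nat \<Rightarrow> real" where
  "frontier_max xs n = Sup (coord_sum ` record_frontier xs n)"

definition frontier_width :: "(nat \<Rightarrow> real^'d) \<Rightarrow> nat \<Rightarrow> real" where
  "frontier_width xs n = frontier_max xs n - frontier_min xs n"

end

theory Submission
  imports Defs "HOL-Real_Asymp.Real_Asymp"
begin

text \<open>
  Almost surely \<open>W\<^sub>n\<close> is the difference of \<open>F\<^sub>n\<^sup>+\<close>, the largest coordinate sum among the first \<open>n\<close>
  sample points, and \<open>F\<^sub>n\<^sup>-\<close>, the least coordinate sum over the (upward closed) record-setting region.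

  The maximum of the Gamma(d) distributed coordinate sums is \<open>ln n + (d - 1) ln ln n\<close> up to
  \<open>o(ln ln n)\<close> in probability and never much less, but since
  \<open>P(S\<^sub>n > ln n + c ln ln n)\<close> is of order \<open>(ln n)\<^bsup>d-1-c\<^esup> / n\<close>, the value
  \<open>c = d\<close> is reached infinitely often, and no larger one.

  The minimum is \<open>ln n + o(ln ln n)\<close>. From below, a union bound over integer points of coordinate sum about
  \<open>ln n - \<epsilon> ln ln n\<close> suffices. From above, a single point \<open>x\<close> of coordinate sum \<open>ln n + \<epsilon> ln ln n\<close>
  is dominated with probability at most \<open>(ln n)\<^bsup>-\<epsilon>\<^esup>\<close>, which is not summable along \<open>n = 2\<^sup>k\<close>; for
  \<open>d \<ge> 2\<close> one uses \<open>m\<close> well separated such points, all of which are dominated with probability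
  about \<open>(ln n)\<^bsup>-m\<epsilon>\<^esup>\<close>.

  Both quantities are nondecreasing in \<open>n\<close>, so almost sure bounds along \<open>n = 2\<^sup>k\<close> extend to all \<open>n\<close>.
\<close>

section \<open>Geometry of the frontier\<close>

text \<open>The infimum runs over the whole region, not its frontier: the regions shrink as
  \<open>n\<close> grows, so monotonicity in \<open>n\<close> holds for every sequence. It agrees
  with \<open>frontier_min\<close> once one of the first \<open>n\<close> points has all coordinates
  positive (\<open>frontier_min_eq\<close>).\<close>

definition region_min :: "(nat \<Rightarrow> real^'d) \<Rightarrow> nat \<Rightarrow> real" where
  "region_min xs n = Inf (coord_sum ` record_region xs n)"

definition sum_max :: "(nat \<Rightarrow> real^'d) \<Rightarrow> nat \<Rightarrow> real" where
  "sum_max xs n = Max ((\<lambda>i. coord_sum (xs i)) ` {1..n})"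

lemma continuous_on_coord_sum: "continuous_on A coord_sum"
  unfolding coord_sum_def by (intro continuous_intros)

lemma coord_sum_measurable [measurable]: "coord_sum \<in> borel_measurable borel"
  by (intro borel_measurable_continuous_onI continuous_on_coord_sum)

lemma coord_sum_scaleR: "coord_sum (s *\<^sub>R x) = s * coord_sum x"
  by (simp add: coord_sum_def sum_distrib_left)

lemma coord_sum_nonneg: "x \<in> orthant \<Longrightarrow> 0 \<le> coord_sum x"
  by (auto simp: orthant_def coord_sum_def intro: sum_nonneg)

lemma component_le_coord_sum: "x \<in> orthant \<Longrightarrow> x $ j \<le> coord_sum x"
  unfolding coord_sum_def by (rule member_le_sum) (auto simp: orthant_def)

lemma coord_sum_strict_mono: "strictly_below x y \<Longrightarrow> coord_sum x < coord_sum y"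
  unfolding coord_sum_def strictly_below_def by (rule sum_strict_mono) auto

lemma closed_orthant: "closed (orthant :: (real^'d) set)"
proof -
  have "orthant = (\<Inter>j. {x :: real^'d. 0 \<le> x $ j})"
    by (auto simp: orthant_def)
  also have "closed \<dots>"
    by (intro closed_INT ballI closed_Collect_le continuous_intros)
  finally show ?thesis .
qed

lemma not_strictly_below_iff: "\<not> strictly_below x y \<longleftrightarrow> (\<exists>j. y $ j \<le> x $ j)"
  by (auto simp: strictly_below_def not_less)

lemma closed_record_region: "closed (record_region xs n)"
proof -
  have "record_region xs n = orthant \<inter> (\<Inter>i\<in>{1..n}. \<Union>j. {x. xs i $ j \<le> x $ j})"
    by (auto simp: record_region_def not_strictly_below_iff)
  then show ?thesis
    by (auto intro!: closed_Int closed_orthant closed_INT closed_UN closed_Collect_le continuous_intros)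
qed

lemma record_region_subset_orthant: "record_region xs n \<subseteq> orthant"
  by (auto simp: record_region_def)

lemma record_region_upward_closed:
  assumes "x \<in> record_region xs n" "\<And>j. x $ j \<le> y $ j"
  shows "y \<in> record_region xs n"
proof -
  have "y \<in> orthant"
    using assms by (auto simp: record_region_def orthant_def intro: order_trans)
  moreover have "\<not> strictly_below y (xs i)" if i: "i \<in> {1..n}" for i
  proof -
    have "\<not> strictly_below x (xs i)" using assms(1) i by (simp add: record_region_def)
    then obtain j where "xs i $ j \<le> x $ j" by (auto simp: not_strictly_below_iff)
    also have "\<dots> \<le> y $ j" by fact
    finally show ?thesis by (auto simp: not_strictly_below_iff)
  qed
  ultimately show ?thesis by (auto simp: record_region_def)
qed

lemma record_region_nonempty: "record_region xs n \<noteq> {}"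
proof -
  \<comment> \<open>A constant vector whose entries exceed all sample coordinates lies in the
    region. Inserting 0 keeps the set nonempty for \<open>n = 0\<close> and puts the vector in the
    orthant.\<close>
  define c where "c = Max (insert 0 ((\<lambda>(i, j). xs i $ j) ` ({1..n} \<times> UNIV)))"
  have fin: "finite (insert 0 ((\<lambda>(i, j). xs i $ j) ` ({1..n} \<times> UNIV)))" by simp
  have 0: "0 \<le> c" unfolding c_def by (rule Max_ge[OF fin]) simp
  have 1: "xs i $ j \<le> c" if "i \<in> {1..n}" for i j
    unfolding c_def by (rule Max_ge[OF fin]) (use that in force)
  have "(\<chi> j. c) \<in> record_region xs n"
    using 0 1 by (auto simp: record_region_def orthant_def not_strictly_below_iff)
  then show ?thesis by auto
qed

section \<open>The least coordinate sum over the region\<close>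

lemma bdd_below_record_region: "bdd_below (coord_sum ` record_region xs n)"
  using record_region_subset_orthant coord_sum_nonneg by (intro bdd_belowI[of _ 0]) auto

lemma region_min_le: "x \<in> record_region xs n \<Longrightarrow> region_min xs n \<le> coord_sum x"
  unfolding region_min_def by (rule cInf_lower) (auto intro: bdd_below_record_region)

lemma region_min_mono:
  assumes "m \<le> n" shows "region_min xs m \<le> region_min xs n"
  unfolding region_min_def
  by (rule cInf_superset_mono)
     (use assms in \<open>auto simp: record_region_nonempty bdd_below_record_region\<close>,
      auto simp: record_region_def intro!: imageI)

lemma region_min_less_iff:
  "region_min xs n < c \<longleftrightarrow> (\<exists>x\<in>record_region xs n. coord_sum x < c)"
  unfolding region_min_def
  by (subst cInf_less_iff) (auto simp: record_region_nonempty bdd_below_record_region)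

text \<open>The region is closed but unbounded. Cutting it at the coordinate sum of one of its
  points \<open>x0\<close> makes it compact, since in the orthant each coordinate is at most the
  sum, and loses no candidate for the minimum.\<close>

lemma region_min_attained:
  obtains x where "x \<in> record_region xs n" "coord_sum x = region_min xs n"
proof -
  obtain x0 where x0: "x0 \<in> record_region xs n"
    using record_region_nonempty by blast
  let ?K = "record_region xs n \<inter> {x. coord_sum x \<le> coord_sum x0}"
  have "bounded ?K"
  proof (rule bounded_subset)
    show "bounded (cbox 0 (\<chi> j. coord_sum x0))" by (rule bounded_cbox)
    show "?K \<subseteq> cbox 0 (\<chi> j. coord_sum x0)"
    proof
      fix x assume x: "x \<in> ?K"
      then have o: "x \<in> orthant" using record_region_subset_orthant by auto
      show "x \<in> cbox 0 (\<chi> j. coord_sum x0)"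
        using x o component_le_coord_sum[OF o]
        by (auto simp: mem_box_cart orthant_def intro: order_trans)
    qed
  qed
  moreover have "closed ?K"
    by (intro closed_Int closed_record_region closed_Collect_le continuous_on_coord_sum continuous_intros)
  ultimately have "compact ?K"
    by (simp add: compact_eq_bounded_closed)
  moreover have "?K \<noteq> {}" using x0 by auto
  ultimately obtain x where x: "x \<in> ?K" "\<And>y. y \<in> ?K \<Longrightarrow> coord_sum x \<le> coord_sum y"
    using continuous_attains_inf[OF _ _ continuous_on_coord_sum] by metis
  have "coord_sum x \<le> coord_sum y" if "y \<in> record_region xs n" for y
    using x that by (cases "coord_sum y \<le> coord_sum x0") auto
  then have "coord_sum x \<le> region_min xs n"
    unfolding region_min_def by (intro cInf_greatest) (auto simp: record_region_nonempty)
  with region_min_le[of x] x that[of x] show ?thesis by fastforce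
qed

section \<open>Extremal coordinate sums on the frontier\<close>

lemma record_frontier_subset: "record_frontier xs n \<subseteq> record_region xs n"
  unfolding record_frontier_def
  by (rule frontier_of_subset_closedin)
     (simp add: closedin_closed_eq closed_orthant closed_record_region record_region_subset_orthant)

text \<open>The points \<open>s *\<^sub>R x\<close> stay in the orthant and tend to \<open>x\<close>
  as \<open>s\<close> increases to 1, so if they all miss the region then \<open>x\<close> is not
  interior relative to the orthant.\<close>

lemma record_frontierI:
  assumes x: "x \<in> record_region xs n"
    and s: "\<And>s. 0 \<le> s \<Longrightarrow> s < 1 \<Longrightarrow> s *\<^sub>R x \<notin> record_region xs n"
  shows "x \<in> record_frontier xs n"
proof -
  have "x \<in> (top_of_set orthant) closure_of record_region xs n"
    using closure_of_subset[of "record_region xs n" "top_of_set orthant"] x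
    by (auto simp: record_region_subset_orthant)
  moreover have "x \<notin> (top_of_set orthant) interior_of record_region xs n"
  proof
    assume "x \<in> (top_of_set orthant) interior_of record_region xs n"
    then obtain U where U: "open U" "x \<in> U" "orthant \<inter> U \<subseteq> record_region xs n"
      by (auto simp: interior_of_def openin_open)
    have "((\<lambda>s. s *\<^sub>R x) \<longlongrightarrow> 1 *\<^sub>R x) (at_left (1::real))"
      by (intro tendsto_intros)
    then have "\<forall>\<^sub>F s in at_left 1. s *\<^sub>R x \<in> U"
      using U by (intro topological_tendstoD[where l = "1 *\<^sub>R x"]) auto
    moreover have "\<forall>\<^sub>F s in at_left (1::real). s \<in> {0<..<1}"
      by (rule eventually_at_left_real) simp
    ultimately have "\<forall>\<^sub>F s in at_left (1::real). False"
    proof eventually_elim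
      case (elim t)
      then have "t *\<^sub>R x \<in> orthant"
        using x by (auto simp: record_region_def orthant_def)
      with elim U s[of t] show False by auto
    qed
    then show False by (simp add: trivial_limit_at_left_real)
  qed
  ultimately show ?thesis by (simp add: record_frontier_def frontier_of_def)
qed

text \<open>Otherwise every strictly positive sample point is exceeded by \<open>x\<close> in some
  coordinate. This is an open condition, and sample points with a coordinate at most 0 strictly
  dominate nothing in the orthant, so a relative neighbourhood of \<open>x\<close> lies in the
  region and \<open>x\<close> is interior.\<close>

lemma record_frontier_below_sample:
  assumes "x \<in> record_frontier xs n"
  shows "\<exists>i\<in>{1..n}. strictly_below 0 (xs i) \<and> (\<forall>j. x $ j \<le> xs i $ j)"
proof (rule ccontr)
  assume contra: "\<not> ?thesis"
  have xr: "x \<in> record_region xs n"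
    using assms record_frontier_subset by auto
  define P where "P = {i \<in> {1..n}. strictly_below 0 (xs i)}"
  define U where "U = (\<Inter>i\<in>P. \<Union>j. {y. xs i $ j < y $ j})"
  have "finite P" by (simp add: P_def)
  then have "open U" unfolding U_def
    by (intro open_INT ballI open_UN open_Collect_less continuous_intros)
  moreover have "x \<in> U" using contra by (force simp: U_def P_def not_le)
  moreover have "orthant \<inter> U \<subseteq> record_region xs n"
  proof
    fix y assume y: "y \<in> orthant \<inter> U"
    have "\<not> strictly_below y (xs i)" if i: "i \<in> {1..n}" for i
    proof (cases "i \<in> P")
      case True
      with y obtain j where "xs i $ j < y $ j" by (auto simp: U_def)
      then show ?thesis by (auto simp: not_strictly_below_iff intro: less_imp_le)
    next
      case False
      then obtain j where "xs i $ j \<le> 0"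
        using i by (auto simp: P_def not_strictly_below_iff)
      with y show ?thesis
        by (auto simp: not_strictly_below_iff orthant_def intro: order_trans)
    qed
    with y show "y \<in> record_region xs n" by (auto simp: record_region_def)
  qed
  ultimately have "openin (top_of_set orthant) (orthant \<inter> U)" "x \<in> orthant \<inter> U"
      "orthant \<inter> U \<subseteq> record_region xs n"
    using xr by (auto simp: openin_open record_region_def)
  then have "x \<in> (top_of_set orthant) interior_of record_region xs n"
    unfolding interior_of_def by blast
  with assms show False by (simp add: record_frontier_def frontier_of_def)
qed

text \<open>A minimizer over the region is on the frontier because shrinking it towards 0 lowers its
  coordinate sum and so leaves the region. This needs a positive sum, which holds since 0 is
  dominated by \<open>xs i\<close> and is therefore not in the region.\<close>

lemma frontier_min_eq:
  assumes "i \<in> {1..n}" "strictly_below 0 (xs i)"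
  shows "frontier_min xs n = region_min xs n"
proof -
  obtain x where x: "x \<in> record_region xs n" "coord_sum x = region_min xs n"
    by (rule region_min_attained)
  have "x \<noteq> 0" using x assms by (auto simp: record_region_def)
  then obtain j where "x $ j \<noteq> 0" by (auto simp: vec_eq_iff)
  moreover have "x \<in> orthant" using x record_region_subset_orthant by auto
  ultimately have pos: "0 < coord_sum x"
    using component_le_coord_sum[of x j] by (auto simp: orthant_def less_le dest: spec[of _ j])
  have "x \<in> record_frontier xs n"
  proof (rule record_frontierI[OF x(1)])
    fix s :: real assume "0 \<le> s" "s < 1"
    then have "coord_sum (s *\<^sub>R x) < region_min xs n"
      using pos x by (simp add: coord_sum_scaleR)
    then show "s *\<^sub>R x \<notin> record_region xs n"
      using region_min_le by fastforce
  qed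
  moreover have "region_min xs n \<le> coord_sum y" if "y \<in> record_frontier xs n" for y
    using that record_frontier_subset region_min_le by blast
  ultimately show ?thesis
    unfolding frontier_min_def x(2)[symmetric]
    by (intro cInf_eq_minimum) auto
qed

text \<open>Sample points with a coordinate at most 0 do not affect the region, so they get the
  value 0, which never wins against a strictly positive point. This version describes the frontier
  for every outcome, not just almost every one.\<close>

definition positive_sum_max :: "(nat \<Rightarrow> real^'d) \<Rightarrow> nat \<Rightarrow> real" where
  "positive_sum_max xs n =
     Max ((\<lambda>i. if strictly_below 0 (xs i) then coord_sum (xs i) else 0) ` {1..n})"

text \<open>A strictly positive sample point of maximal coordinate sum is dominated by no other
  sample point, so it lies in the region, and it dominates its own shrinkings, so it lies on the
  frontier. Conversely each frontier point lies weakly below a strictly positive sample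
  point.\<close>

lemma frontier_max_eq:
  assumes i: "i \<in> {1..n}" "strictly_below 0 (xs i)"
  shows "frontier_max xs n = positive_sum_max xs n"
proof -
  let ?f = "\<lambda>i. if strictly_below 0 (xs i) then coord_sum (xs i) else 0"
  have le: "?f k \<le> positive_sum_max xs n" if "k \<in> {1..n}" for k
    unfolding positive_sum_max_def using that by (intro Max_ge) auto
  have "positive_sum_max xs n \<in> ?f ` {1..n}"
    unfolding positive_sum_max_def using i by (intro Max_in) auto
  then obtain k where k: "k \<in> {1..n}" "positive_sum_max xs n = ?f k" by auto
  have "0 < coord_sum (xs i)" using coord_sum_strict_mono[OF i(2)] by (simp add: coord_sum_def)
  then have "0 < ?f k" using le[OF i(1)] i k by auto
  then have pk: "strictly_below 0 (xs k)" "positive_sum_max xs n = coord_sum (xs k)"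
    using k by (auto split: if_splits)
  have reg: "xs k \<in> record_region xs n"
  proof -
    have "\<not> strictly_below (xs k) (xs m)" if "m \<in> {1..n}" for m
    proof
      assume *: "strictly_below (xs k) (xs m)"
      then have "strictly_below 0 (xs m)"
        using pk by (auto simp: strictly_below_def intro: less_trans)
      with le[OF that] pk coord_sum_strict_mono[OF *] show False by auto
    qed
    moreover have "xs k \<in> orthant" using pk by (auto simp: orthant_def strictly_below_def intro: less_imp_le)
    ultimately show ?thesis by (auto simp: record_region_def)
  qed
  have "xs k \<in> record_frontier xs n"
  proof (rule record_frontierI[OF reg])
    fix s :: real assume "0 \<le> s" "s < 1"
    then have "strictly_below (s *\<^sub>R xs k) (xs k)"
      using pk by (auto simp: strictly_below_def)
    then show "s *\<^sub>R xs k \<notin> record_region xs n"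
      using k by (auto simp: record_region_def)
  qed
  moreover have "coord_sum y \<le> positive_sum_max xs n" if "y \<in> record_frontier xs n" for y
  proof -
    obtain m where m: "m \<in> {1..n}" "strictly_below 0 (xs m)" "\<And>j. y $ j \<le> xs m $ j"
      using record_frontier_below_sample[OF \<open>y \<in> record_frontier xs n\<close>] by blast
    have "coord_sum y \<le> coord_sum (xs m)"
      unfolding coord_sum_def by (intro sum_mono m)
    with le[OF m(1)] m show ?thesis by auto
  qed
  ultimately show ?thesis
    unfolding frontier_max_def using pk
    by (intro cSup_eq_maximum) auto
qed

text \<open>A formula valid for every outcome, from which measurability of the width follows
  directly. Without a strictly positive sample point the frontier is empty and the width is a fixed
  constant.\<close>

lemma frontier_width_eq:
  "frontier_width xs n =
     (if \<exists>i\<in>{1..n}. strictly_below 0 (xs i) then positive_sum_max xs n - region_min xs n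
      else Sup {} - Inf {})"
proof (cases "\<exists>i\<in>{1..n}. strictly_below 0 (xs i)")
  case True
  then show ?thesis
    by (auto simp: frontier_width_def frontier_min_eq frontier_max_eq)
next
  case False
  then have "record_frontier xs n = {}"
    using record_frontier_below_sample[of _ xs n] by blast
  with False show ?thesis
    by (auto simp: frontier_width_def frontier_min_def frontier_max_def)
qed

lemma frontier_width_eq_of_positive:
  assumes "n \<ge> 1" "\<And>i. i \<in> {1..n} \<Longrightarrow> strictly_below 0 (xs i)"
  shows "frontier_width xs n = sum_max xs n - region_min xs n"
proof -
  have "positive_sum_max xs n = sum_max xs n"
    unfolding positive_sum_max_def sum_max_def
    by (rule arg_cong[where f = Max], rule image_cong) (use assms in auto)
  moreover have "\<exists>i\<in>{1..n}. strictly_below 0 (xs i)"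
    using assms by (intro bexI[of _ 1]) auto
  ultimately show ?thesis
    by (simp add: frontier_width_eq)
qed

lemma sum_max_mono:
  assumes "1 \<le> m" "m \<le> n" shows "sum_max xs m \<le> sum_max xs n"
  unfolding sum_max_def using assms by (intro Max_mono) auto

lemma sum_max_le_iff:
  "1 \<le> n \<Longrightarrow> sum_max xs n \<le> a \<longleftrightarrow> (\<forall>i\<in>{1..n}. coord_sum (xs i) \<le> a)"
  unfolding sum_max_def by (subst Max_le_iff) auto

section \<open>Tail bounds at a fixed time\<close>

text \<open>For \<open>d\<close> at least 1 and \<open>a\<close> nonnegative this is the probability
  that a sum of \<open>d\<close> independent Exponential(1) variables exceeds \<open>a\<close>,
  equivalently that a Poisson variable with mean \<open>a\<close> is below \<open>d\<close>.\<close>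

definition erlang_tail :: "nat \<Rightarrow> real \<Rightarrow> real" where
  "erlang_tail d a = exp (- a) * (\<Sum>k<d. a ^ k / fact k)"

lemma open_strictly_above: "open {y. strictly_below x y}"
proof -
  have "{y. strictly_below x y} = (\<Inter>j. {y. x $ j < y $ j})"
    by (auto simp: strictly_below_def)
  also have "open \<dots>"
    by (intro open_INT ballI open_Collect_less continuous_intros) auto
  finally show ?thesis .
qed

lemma strictly_above_borel [measurable]: "{y. strictly_below x y} \<in> sets borel"
  by (intro borel_open open_strictly_above)

locale exponential_sample = prob_space M for M :: "'a measure" +
  fixes X :: "nat \<Rightarrow> 'a \<Rightarrow> real^'d"
  assumes X_meas: "\<And>i. i \<ge> 1 \<Longrightarrow> X i \<in> borel_measurable M"
    and X_indep: "indep_vars (\<lambda>_. borel) X {1..}"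
    and coord_indep: "\<And>i. i \<ge> 1 \<Longrightarrow> indep_vars (\<lambda>_. borel) (\<lambda>j \<omega>. X i \<omega> $ j) UNIV"
    and coord_exp: "\<And>i j. i \<ge> 1 \<Longrightarrow>
          distributed M lborel (\<lambda>\<omega>. X i \<omega> $ j) (exponential_density 1)"
begin

abbreviation sample :: "'a \<Rightarrow> nat \<Rightarrow> real^'d" where
  "sample \<omega> \<equiv> \<lambda>i. X i \<omega>"

lemma X_event: "i \<ge> 1 \<Longrightarrow> A \<in> sets borel \<Longrightarrow> {\<omega> \<in> space M. X i \<omega> \<in> A} \<in> events"
  using measurable_sets[OF X_meas, of i A] by (simp add: vimage_def Int_def conj_commute)

lemma dominated_event: "i \<ge> 1 \<Longrightarrow> {\<omega> \<in> space M. strictly_below x (X i \<omega>)} \<in> events"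
  using X_event[OF _ strictly_above_borel[of x]] by simp

lemma prob_dominated:
  assumes x: "x \<in> orthant" and i: "i \<ge> 1"
  shows "prob {\<omega> \<in> space M. strictly_below x (X i \<omega>)} = exp (- coord_sum x)"
proof -
  have "{\<omega> \<in> space M. strictly_below x (X i \<omega>)} =
        (\<Inter>j\<in>UNIV. (\<lambda>\<omega>. X i \<omega> $ j) -` {x $ j<..} \<inter> space M)"
    by (auto simp: strictly_below_def)
  also have "prob \<dots> = (\<Prod>j\<in>UNIV. prob ((\<lambda>\<omega>. X i \<omega> $ j) -` {x $ j<..} \<inter> space M))"
    by (rule indep_varsD_finite[OF coord_indep[OF i]]) auto
  also have "\<dots> = (\<Prod>j\<in>UNIV. exp (- x $ j))"
  proof (rule prod.cong[OF refl])
    fix j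
    have "(\<lambda>\<omega>. X i \<omega> $ j) -` {x $ j<..} \<inter> space M = {\<omega> \<in> space M. x $ j < X i \<omega> $ j}" by auto
    then show "prob ((\<lambda>\<omega>. X i \<omega> $ j) -` {x $ j<..} \<inter> space M) = exp (- x $ j)"
      using exponential_distributedD_gt[OF coord_exp[OF i], of "x $ j" j] x
      by (simp add: orthant_def)
  qed
  also have "\<dots> = exp (- coord_sum x)"
    by (simp add: coord_sum_def exp_sum sum_negf[symmetric])
  finally show ?thesis .
qed

lemma prob_family:
  assumes J: "finite J" "J \<subseteq> {1..}" and A: "\<And>i. i \<in> J \<Longrightarrow> A i \<in> sets borel"
  shows "prob {\<omega> \<in> space M. \<forall>i\<in>J. X i \<omega> \<in> A i} = (\<Prod>i\<in>J. prob {\<omega> \<in> space M. X i \<omega> \<in> A i})"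
\<comment> \<open>The empty family is treated apart because an empty intersection of preimages is
  not \<open>space M\<close>.\<close>
proof (cases "J = {}")
  case True
  then show ?thesis by (simp add: prob_space)
next
  case False
  have "{\<omega> \<in> space M. \<forall>i\<in>J. X i \<omega> \<in> A i} = (\<Inter>i\<in>J. X i -` A i \<inter> space M)"
    using False by auto
  also have "prob \<dots> = (\<Prod>i\<in>J. prob (X i -` A i \<inter> space M))"
    by (rule indep_varsD[OF X_indep]) (use J A False in auto)
  finally show ?thesis by (simp add: vimage_def Int_def conj_commute)
qed

lemma X_ball_event:
  assumes J: "finite J" "J \<subseteq> {1..}" and A: "\<And>i. i \<in> J \<Longrightarrow> A i \<in> sets borel"
  shows "{\<omega> \<in> space M. \<forall>i\<in>J. X i \<omega> \<in> A i} \<in> events"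
  by (rule sets.sets_Collect_finite_All[OF _ J(1)]) (use J A in \<open>auto intro!: X_event\<close>)

lemma record_region_event: "{\<omega> \<in> space M. x \<in> record_region (sample \<omega>) n} \<in> events"
proof (cases "x \<in> orthant")
  case True
  then have "{\<omega> \<in> space M. x \<in> record_region (sample \<omega>) n} =
      {\<omega> \<in> space M. \<forall>i\<in>{1..n}. X i \<omega> \<in> - {y. strictly_below x y}}"
    by (auto simp: record_region_def)
  then show ?thesis using X_ball_event[of "{1..n}" "\<lambda>_. - {y. strictly_below x y}"] by auto
qed (simp add: record_region_def)

text \<open>Each sample point independently misses domination of \<open>x\<close> with probability
  \<open>1 - exp (- coord_sum x)\<close>, and \<open>1 - t\<close> is at most
  \<open>exp (- t)\<close>.\<close>

lemma prob_record_region_le: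
  assumes x: "x \<in> orthant"
  shows "prob {\<omega> \<in> space M. x \<in> record_region (sample \<omega>) n} \<le> exp (- (real n * exp (- coord_sum x)))"
proof -
  have "{\<omega> \<in> space M. x \<in> record_region (sample \<omega>) n} =
      {\<omega> \<in> space M. \<forall>i\<in>{1..n}. X i \<omega> \<in> - {y. strictly_below x y}}"
    using x by (auto simp: record_region_def)
  also have "prob \<dots> = (\<Prod>i\<in>{1..n}. prob {\<omega> \<in> space M. X i \<omega> \<in> - {y. strictly_below x y}})"
    by (rule prob_family) auto
  also have "\<dots> = (\<Prod>i\<in>{1..n}. 1 - exp (- coord_sum x))"
  proof (rule prod.cong[OF refl])
    fix i assume i: "i \<in> {1..n}"
    show "prob {\<omega> \<in> space M. X i \<omega> \<in> - {y. strictly_below x y}} = 1 - exp (- coord_sum x)"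
      using prob_neg[OF dominated_event[of i x]] prob_dominated[OF x, of i] i by simp
  qed
  also have "\<dots> = (1 - exp (- coord_sum x)) ^ n" by simp
  also have "\<dots> \<le> exp (- exp (- coord_sum x)) ^ n"
    using exp_ge_add_one_self[of "- exp (- coord_sum x)"] coord_sum_nonneg[OF x]
    by (intro power_mono) auto
  also have "\<dots> = exp (- (real n * exp (- coord_sum x)))"
    by (simp add: exp_of_nat_mult[symmetric])
  finally show ?thesis .
qed

lemma prob_coord_sum_gt:
  assumes i: "i \<ge> 1" and a: "0 \<le> a"
  shows "prob {\<omega> \<in> space M. a < coord_sum (X i \<omega>)} = erlang_tail CARD('d) a"
proof -
  \<comment> \<open>The shape index of \<open>erlang_density\<close> is one less than the number of
    exponential summands.\<close>
  have "distributed M lborel (\<lambda>\<omega>. coord_sum (X i \<omega>)) (erlang_density (CARD('d) - 1) 1)"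
    unfolding coord_sum_def
    by (rule exponential_distributed_sum) (auto simp: coord_exp[OF i] coord_indep[OF i])
  from erlang_distributed_gt[OF this _ a]
  have "prob {\<omega> \<in> space M. a < coord_sum (X i \<omega>)} = (\<Sum>n\<le>CARD('d) - 1. a ^ n * exp (- a) / fact n)"
    using a by (simp add: erlang_CDF_def)
  also have "{..CARD('d) - 1} = {..<CARD('d)}"
    using lessThan_Suc_atMost[of "CARD('d) - 1"] by simp
  finally show ?thesis
    by (simp add: erlang_tail_def sum_distrib_left mult.commute)
qed

lemma coord_sum_event: "i \<ge> 1 \<Longrightarrow> {\<omega> \<in> space M. a < coord_sum (X i \<omega>)} \<in> events"
  using X_event[of i "{x. a < coord_sum x}"] by auto

lemma erlang_tail_le_1: "0 \<le> a \<Longrightarrow> erlang_tail CARD('d) a \<le> 1"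
  using prob_coord_sum_gt[of 1 a] prob_le_1 by (metis le_refl)

text \<open>Independence gives a product of factors \<open>1 - t\<close>, each at most
  \<open>exp (- t)\<close>. The levels \<open>b i\<close> may vary with \<open>i\<close>: a constant
  level bounds \<open>sum_max\<close> at a fixed time, growing levels serve the second
  Borel-Cantelli argument.\<close>

lemma prob_coord_sums_le:
  assumes J: "finite J" "J \<subseteq> {1..}" and b: "\<And>i. i \<in> J \<Longrightarrow> 0 \<le> b i"
  shows "prob {\<omega> \<in> space M. \<forall>i\<in>J. coord_sum (X i \<omega>) \<le> b i} \<le> exp (- (\<Sum>i\<in>J. erlang_tail CARD('d) (b i)))"
proof -
  have "prob {\<omega> \<in> space M. \<forall>i\<in>J. coord_sum (X i \<omega>) \<le> b i} =
      prob {\<omega> \<in> space M. \<forall>i\<in>J. X i \<omega> \<in> {x. coord_sum x \<le> b i}}" by simp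
  also have "\<dots> = (\<Prod>i\<in>J. prob {\<omega> \<in> space M. X i \<omega> \<in> {x. coord_sum x \<le> b i}})"
    by (rule prob_family[OF J]) auto
  also have "\<dots> = (\<Prod>i\<in>J. 1 - erlang_tail CARD('d) (b i))"
  proof (rule prod.cong[OF refl])
    fix i assume "i \<in> J"
    then have i: "i \<ge> 1" "0 \<le> b i" using J b by auto
    show "prob {\<omega> \<in> space M. X i \<omega> \<in> {x. coord_sum x \<le> b i}} = 1 - erlang_tail CARD('d) (b i)"
      using prob_neg[OF coord_sum_event[OF i(1), of "b i"]] prob_coord_sum_gt[OF i] by (simp add: not_less)
  qed
  also have "\<dots> \<le> (\<Prod>i\<in>J. exp (- erlang_tail CARD('d) (b i)))"
  proof (rule prod_mono)
    fix i assume "i \<in> J"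
    then show "0 \<le> 1 - erlang_tail CARD('d) (b i) \<and>
        1 - erlang_tail CARD('d) (b i) \<le> exp (- erlang_tail CARD('d) (b i))"
      using exp_ge_add_one_self[of "- erlang_tail CARD('d) (b i)"] erlang_tail_le_1[OF b] by auto
  qed
  also have "\<dots> = exp (- (\<Sum>i\<in>J. erlang_tail CARD('d) (b i)))"
    using J by (simp add: exp_sum sum_negf[symmetric])
  finally show ?thesis .
qed

lemma prob_sum_max_le:
  assumes "n \<ge> 1" "0 \<le> a"
  shows "prob {\<omega> \<in> space M. sum_max (sample \<omega>) n \<le> a} \<le> exp (- (real n * erlang_tail CARD('d) a))"
  using prob_coord_sums_le[of "{1..n}" "\<lambda>_. a"] assms by (simp add: sum_max_le_iff)

lemma prob_sum_max_gt:
  assumes "n \<ge> 1" "0 \<le> a"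
  shows "prob {\<omega> \<in> space M. a < sum_max (sample \<omega>) n} \<le> real n * erlang_tail CARD('d) a"
proof -
  have "{\<omega> \<in> space M. a < sum_max (sample \<omega>) n} = (\<Union>i\<in>{1..n}. {\<omega> \<in> space M. a < coord_sum (X i \<omega>)})"
    using assms sum_max_le_iff[of n _ a] by (auto simp: not_le[symmetric])
  also have "prob \<dots> \<le> (\<Sum>i\<in>{1..n}. prob {\<omega> \<in> space M. a < coord_sum (X i \<omega>)})"
    by (rule finite_measure_subadditive_finite) (auto intro!: coord_sum_event)
  also have "\<dots> = (\<Sum>i\<in>{1..n}. erlang_tail CARD('d) a)"
    by (rule sum.cong[OF refl]) (simp add: prob_coord_sum_gt assms)
  finally show ?thesis by simp
qed

section \<open>Measurability of the minimum, the maximum and the width\<close>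

lemma region_min_measurable [measurable]: "(\<lambda>\<omega>. region_min (sample \<omega>) n) \<in> borel_measurable M"
proof (rule borel_measurableI_less)
  fix c :: real
  \<comment> \<open>A countable dense set suffices as a source of witnesses: the points strictly
    above a witness and still of sum below \<open>c\<close> form a nonempty open set, which lies in
    the region outside which no upward move leads.\<close>
  obtain D :: "(real^'d) set" where D: "countable D" "\<And>U. open U \<Longrightarrow> U \<noteq> {} \<Longrightarrow> \<exists>d\<in>D. d \<in> U"
    by (rule countable_dense_setE) blast
  have "{\<omega> \<in> space M. region_min (sample \<omega>) n < c} =
      (\<Union>q\<in>{q\<in>D. coord_sum q < c}. {\<omega> \<in> space M. q \<in> record_region (sample \<omega>) n})" (is "?L = ?R")
  proof (intro equalityI subsetI)
    fix \<omega> assume "\<omega> \<in> ?L"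
    then obtain x where x: "\<omega> \<in> space M" "x \<in> record_region (sample \<omega>) n" "coord_sum x < c"
      by (auto simp: region_min_less_iff)
    define U where "U = {y. strictly_below x y} \<inter> {y. coord_sum y < c}"
    have "open U" unfolding U_def
      by (intro open_Int open_strictly_above open_Collect_less continuous_on_coord_sum continuous_intros)
    moreover have "U \<noteq> {}"
    proof -
      \<comment> \<open>Half of the slack \<open>c - coord_sum x\<close>, spread evenly over the
        coordinates.\<close>
      define e where "e = (c - coord_sum x) / (2 * CARD('d))"
      have "e > 0" using x by (simp add: e_def)
      have "coord_sum (\<chi> j. x $ j + e) = coord_sum x + (c - coord_sum x) / 2"
        by (simp add: coord_sum_def sum.distrib e_def)
      then have "(\<chi> j. x $ j + e) \<in> U"
        using \<open>e > 0\<close> x by (simp add: U_def strictly_below_def field_simps)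
      then show ?thesis by auto
    qed
    ultimately obtain q where q: "q \<in> D" "q \<in> U" using D by metis
    then have "q \<in> record_region (sample \<omega>) n"
      using record_region_upward_closed[OF x(2), of q]
      by (auto simp: U_def strictly_below_def intro: less_imp_le)
    with q x show "\<omega> \<in> ?R" by (auto simp: U_def)
  next
    fix \<omega> assume "\<omega> \<in> ?R"
    then show "\<omega> \<in> ?L" by (auto simp: region_min_less_iff)
  qed
  also have "\<dots> \<in> events"
    by (rule sets.countable_UN') (use D record_region_event in auto)
  finally show "{\<omega> \<in> space M. region_min (sample \<omega>) n < c} \<in> events" .
qed

lemma coord_sum_X_measurable: "i \<ge> 1 \<Longrightarrow> (\<lambda>\<omega>. coord_sum (X i \<omega>)) \<in> borel_measurable M"
  by (rule measurable_compose[OF X_meas coord_sum_measurable])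

lemma sum_max_measurable [measurable]: "(\<lambda>\<omega>. sum_max (sample \<omega>) n) \<in> borel_measurable M"
  unfolding sum_max_def by (rule borel_measurable_Max) (auto intro: coord_sum_X_measurable)

lemma frontier_width_measurable: "(\<lambda>\<omega>. frontier_width (sample \<omega>) n) \<in> borel_measurable M"
  unfolding frontier_width_eq positive_sum_max_def
proof (intro measurable_If borel_measurable_diff region_min_measurable borel_measurable_Max
    borel_measurable_const)
  show "{\<omega> \<in> space M. \<exists>i\<in>{1..n}. strictly_below 0 (X i \<omega>)} \<in> events"
    by (rule sets.sets_Collect_finite_Ex) (auto intro!: dominated_event)
qed (auto intro!: coord_sum_X_measurable dominated_event)

lemma AE_sample_positive: "AE \<omega> in M. \<forall>i\<ge>1. strictly_below 0 (X i \<omega>)"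
proof -
  have "AE \<omega> in M. i \<ge> 1 \<longrightarrow> strictly_below 0 (X i \<omega>)" for i
  proof (cases "i \<ge> 1")
    case True
    have "prob {\<omega> \<in> space M. strictly_below 0 (X i \<omega>)} = 1"
      using prob_dominated[of 0 i] True by (simp add: orthant_def coord_sum_def)
    then show ?thesis
      using prob_eq_1[OF dominated_event[OF True, of 0]] by auto
  qed simp
  then show ?thesis by (simp add: AE_all_countable)
qed

lemma AE_frontier_width:
  "AE \<omega> in M. \<forall>n\<ge>1. frontier_width (sample \<omega>) n = sum_max (sample \<omega>) n - region_min (sample \<omega>) n"
  using AE_sample_positive by eventually_elim (auto intro!: frontier_width_eq_of_positive)

text \<open>The event that no \<open>p l\<close> lies in the record-setting region is covered by two others:
  distinct sample points dominate the different \<open>p l\<close>, or one sample point dominates two of them.\<close>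
lemma prob_no_point_in_region:
  fixes p :: "nat \<Rightarrow> real^'d"
  assumes m: "m \<ge> 1"
    and orth: "\<And>l. l < m \<Longrightarrow> p l \<in> orthant"
    and a: "\<And>l. l < m \<Longrightarrow> coord_sum (p l) = a"
    and b: "\<And>l l'. l < l' \<Longrightarrow> l' < m \<Longrightarrow> b \<le> coord_sum (\<chi> j. max (p l $ j) (p l' $ j))"
  shows "prob {\<omega> \<in> space M. \<forall>l<m. p l \<notin> record_region (sample \<omega>) n} \<le>
           (real n * exp (- a)) ^ m + real m ^ 2 * (real n * exp (- b))"
proof -
  \<comment> \<open>Injective choices of a dominating sample point for each \<open>p l\<close>.
    Extensionality of the functions makes their number at most \<open>n ^ m\<close>.\<close>
  define F where "F = {f \<in> {..<m} \<rightarrow>\<^sub>E {1..n}. inj_on f {..<m}}"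
  \<comment> \<open>Indexing by the image of \<open>f\<close> gives each sample point one
    constraint, the form required by \<open>prob_family\<close>; \<open>inv_into\<close> recovers
    the \<open>l\<close> to which \<open>i\<close> was assigned.\<close>
  define E where "E f = {\<omega> \<in> space M. \<forall>i\<in>f ` {..<m}. X i \<omega> \<in> {y. strictly_below (p (inv_into {..<m} f i)) y}}" for f
  define G where "G = {(l, l'). l < l' \<and> l' < m} \<times> {1..n}"
  \<comment> \<open>A sample point dominates both \<open>p l\<close> and \<open>p l'\<close> exactly
    when it dominates their coordinatewise maximum.\<close>
  define q where "q l l' = (\<chi> j. max (p l $ j) (p l' $ j))" for l l'
  define H where "H = (\<lambda>((l, l'), i). {\<omega> \<in> space M. strictly_below (q l l') (X i \<omega>)})"
  have "finite F" unfolding F_def by (rule finite_subset[of _ "{..<m} \<rightarrow>\<^sub>E {1..n}"]) (auto intro: finite_PiE)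
  have Gsub: "G \<subseteq> ({..<m} \<times> {..<m}) \<times> {1..n}" by (auto simp: G_def)
  then have "finite G" by (rule finite_subset) auto
  have F_range: "f ` {..<m} \<subseteq> {1..n}" if "f \<in> F" for f
    using that by (auto simp: F_def PiE_def Pi_def)
  have E_event: "E f \<in> events" if "f \<in> F" for f
    unfolding E_def
    by (rule X_ball_event) (use F_range[OF that] in \<open>auto intro!: strictly_above_borel\<close>)
  have H_event: "H g \<in> events" if "g \<in> G" for g
    using that by (auto simp: H_def G_def intro!: dominated_event)
  have q_orth: "q l l' \<in> orthant" if "l < l'" "l' < m" for l l'
    using orth[of l] orth[of l'] that by (auto simp: q_def orthant_def max_def)
  have "{\<omega> \<in> space M. \<forall>l<m. p l \<notin> record_region (sample \<omega>) n} \<subseteq> (\<Union>f\<in>F. E f) \<union> (\<Union>g\<in>G. H g)"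
  proof
    fix \<omega> assume "\<omega> \<in> {\<omega> \<in> space M. \<forall>l<m. p l \<notin> record_region (sample \<omega>) n}"
    then have \<omega>: "\<omega> \<in> space M" and *: "\<And>l. l < m \<Longrightarrow> p l \<notin> record_region (sample \<omega>) n"
      by auto
    have "\<exists>i\<in>{1..n}. strictly_below (p l) (X i \<omega>)" if "l < m" for l
      using orth[OF that] *[OF that] by (simp add: record_region_def)
    then obtain g where
      g: "\<And>l. l < m \<Longrightarrow> g l \<in> {1..n} \<and> strictly_below (p l) (X (g l) \<omega>)" by metis
    define f where "f = restrict g {..<m}"
    show "\<omega> \<in> (\<Union>f\<in>F. E f) \<union> (\<Union>g\<in>G. H g)"
    proof (cases "inj_on f {..<m}")
      case True
      then have "f \<in> F" using g by (auto simp: F_def f_def)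
      moreover have "\<omega> \<in> E f"
        using \<omega> g True by (auto simp: E_def inv_into_f_f) (auto simp: f_def)
      ultimately show ?thesis by auto
    next
      case False
      then obtain l l' where l: "l < m" "l' < m" "l \<noteq> l'" "f l = f l'"
        by (auto simp: inj_on_def)
      have *: "\<exists>g\<in>G. \<omega> \<in> H g" if "l < l'" "l' < m" "f l = f l'" for l l'
      proof (rule bexI[of _ "((l, l'), f l)"])
        show "((l, l'), f l) \<in> G" using that g[of l] by (auto simp: G_def f_def)
        show "\<omega> \<in> H ((l, l'), f l)"
          using that g[of l] g[of l'] \<omega> by (auto simp: H_def q_def f_def strictly_below_def)
      qed
      from l consider "l < l'" | "l' < l" by linarith
      then have "\<exists>g\<in>G. \<omega> \<in> H g" using * l by cases metis+
      then show ?thesis by blast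
    qed
  qed
  then have "prob {\<omega> \<in> space M. \<forall>l<m. p l \<notin> record_region (sample \<omega>) n} \<le>
      prob ((\<Union>f\<in>F. E f) \<union> (\<Union>g\<in>G. H g))"
    using \<open>finite F\<close> \<open>finite G\<close> E_event H_event
    by (intro finite_measure_mono sets.Un sets.finite_UN) auto
  also have "\<dots> \<le> prob (\<Union>f\<in>F. E f) + prob (\<Union>g\<in>G. H g)"
    using \<open>finite F\<close> \<open>finite G\<close> E_event H_event
    by (intro measure_Un_le sets.finite_UN) auto
  also have "prob (\<Union>f\<in>F. E f) \<le> (\<Sum>f\<in>F. prob (E f))"
    using \<open>finite F\<close> E_event by (intro finite_measure_subadditive_finite) auto
  also have "(\<Sum>f\<in>F. prob (E f)) = (\<Sum>f\<in>F. exp (- a) ^ m)"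
  proof (rule sum.cong[OF refl])
    fix f assume f: "f \<in> F"
    have inj: "inj_on f {..<m}" using f by (simp add: F_def)
    note fn = F_range[OF f]
    have "prob (E f) = (\<Prod>i\<in>f ` {..<m}. prob {\<omega> \<in> space M. X i \<omega> \<in> {y. strictly_below (p (inv_into {..<m} f i)) y}})"
      unfolding E_def by (rule prob_family) (use fn in \<open>auto intro!: strictly_above_borel\<close>)
    also have "\<dots> = (\<Prod>l<m. prob {\<omega> \<in> space M. strictly_below (p l) (X (f l) \<omega>)})"
      using inj by (subst prod.reindex) (auto intro!: prod.cong)
    also have "\<dots> = (\<Prod>l<m. exp (- a))"
    proof (rule prod.cong[OF refl])
      fix l assume "l \<in> {..<m}"
      then have "l < m" "f l \<ge> 1" using fn by auto
      then show "prob {\<omega> \<in> space M. strictly_below (p l) (X (f l) \<omega>)} = exp (- a)"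
        by (simp add: prob_dominated orth a)
    qed
    finally show "prob (E f) = exp (- a) ^ m" by simp
  qed
  also have "\<dots> = real (card F) * exp (- a) ^ m" by simp
  also have "\<dots> \<le> real (n ^ m) * exp (- a) ^ m"
  proof -
    have "card F \<le> card ({..<m} \<rightarrow>\<^sub>E {1..n})"
      by (rule card_mono) (auto simp: F_def intro: finite_PiE)
    also have "\<dots> = n ^ m" by (simp add: card_PiE)
    finally show ?thesis by (intro mult_right_mono) auto
  qed
  also have "\<dots> = (real n * exp (- a)) ^ m" by (simp add: power_mult_distrib)
  also have "prob (\<Union>g\<in>G. H g) \<le> (\<Sum>g\<in>G. prob (H g))"
    using \<open>finite G\<close> H_event by (intro finite_measure_subadditive_finite) auto
  also have "\<dots> \<le> (\<Sum>g\<in>G. exp (- b))"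
  proof (rule sum_mono)
    fix g assume "g \<in> G"
    then obtain l l' i where g: "g = ((l, l'), i)" "l < l'" "l' < m" "i \<ge> 1"
      by (auto simp: G_def)
    then show "prob (H g) \<le> exp (- b)"
      using b[of l l'] by (simp add: H_def prob_dominated q_orth) (simp add: q_def)
  qed
  also have "\<dots> = real (card G) * exp (- b)" by simp
  also have "\<dots> \<le> real (m * m * n) * exp (- b)"
  proof -
    have "card G \<le> card (({..<m} \<times> {..<m}) \<times> {1..n})"
      by (rule card_mono[OF _ Gsub]) auto
    also have "\<dots> = m * m * n" by (simp add: card_cartesian_product)
    finally have "real (card G) \<le> real (m * m * n)" by (rule of_nat_mono)
    then show ?thesis by (rule mult_right_mono) simp
  qed
  also have "\<dots> = real m ^ 2 * (real n * exp (- b))" by (simp add: power2_eq_square)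
  finally show ?thesis by simp
qed

text \<open>The \<open>m\<close> test points are equally spaced on the segment from \<open>a\<close>
  times the unit vector at \<open>j\<^sub>1\<close> towards \<open>a\<close> times the one at
  \<open>j\<^sub>2\<close>. All have sum \<open>a\<close>, and the join of two of them has sum at
  least \<open>a + a / m\<close>. For \<open>m = 1\<close> there is a single point and no pair, so
  the bound also covers dimension one.\<close>

lemma prob_region_min_gt:
  fixes j\<^sub>1 j\<^sub>2 :: 'd
  assumes m: "m \<ge> 1" and a: "0 \<le> a" and j: "m = 1 \<or> j\<^sub>1 \<noteq> j\<^sub>2"
  shows "prob {\<omega> \<in> space M. a < region_min (sample \<omega>) n} \<le>
           (real n * exp (- a)) ^ m + real m ^ 2 * (real n * exp (- (a + a / m)))"
proof -
  define p :: "nat \<Rightarrow> real^'d"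
    where "p l = (\<chi> j. (if j = j\<^sub>1 then a - l * (a / m) else 0) + (if j = j\<^sub>2 then l * (a / m) else 0))" for l
  have la: "l * (a / m) \<le> a" if "l < m" for l
  proof -
    have "a * real l \<le> a * real m" using that a by (intro mult_left_mono) auto
    then show ?thesis using m by (simp add: field_simps)
  qed
  have orth: "p l \<in> orthant" if "l < m" for l
    using la[OF that] a by (auto simp: orthant_def p_def)
  have sum: "coord_sum (p l) = a" for l
    by (simp add: coord_sum_def p_def sum.distrib)
  have join: "a + a / m \<le> coord_sum (\<chi> j. max (p l $ j) (p l' $ j))" if l: "l < l'" "l' < m" for l l'
  proof -
    \<comment> \<open>The existence of a pair \<open>l < l' < m\<close> excludes
      \<open>m = 1\<close>.\<close>
    have ne: "j\<^sub>1 \<noteq> j\<^sub>2" using j l by auto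
    have "a / m \<le> (real l' - real l) * (a / m)"
      using mult_right_mono[of 1 "real l' - real l" "a / m"] l a by simp
    then have "a + a / m \<le> (a - l * (a / m)) + l' * (a / m)" by (simp add: algebra_simps)
    also have "\<dots> = (\<Sum>j\<in>UNIV. (if j = j\<^sub>1 then a - l * (a / m) else 0) + (if j = j\<^sub>2 then l' * (a / m) else 0))"
      by (simp add: sum.distrib)
    also have "\<dots> \<le> (\<Sum>j\<in>UNIV. max (p l $ j) (p l' $ j))"
    proof (rule sum_mono)
      fix j
      show "(if j = j\<^sub>1 then a - l * (a / m) else 0) + (if j = j\<^sub>2 then l' * (a / m) else 0) \<le> max (p l $ j) (p l' $ j)"
        using ne by (auto simp: p_def)
    qed
    finally show ?thesis by (simp add: coord_sum_def)
  qed
  have "prob {\<omega> \<in> space M. a < region_min (sample \<omega>) n} \<le>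
      prob {\<omega> \<in> space M. \<forall>l<m. p l \<notin> record_region (sample \<omega>) n}"
  proof (rule finite_measure_mono)
    show "{\<omega> \<in> space M. a < region_min (sample \<omega>) n} \<subseteq> {\<omega> \<in> space M. \<forall>l<m. p l \<notin> record_region (sample \<omega>) n}"
      by (auto dest!: region_min_le simp: sum)
    have "{\<omega> \<in> space M. \<forall>l\<in>{..<m}. p l \<notin> record_region (sample \<omega>) n} \<in> events"
      by (intro sets.sets_Collect_finite_All sets.sets_Collect_neg record_region_event) auto
    then show "{\<omega> \<in> space M. \<forall>l<m. p l \<notin> record_region (sample \<omega>) n} \<in> events"
      unfolding Ball_def lessThan_iff .
  qed
  also have "\<dots> \<le> (real n * exp (- a)) ^ m + real m ^ 2 * (real n * exp (- (a + a / m)))"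
    by (rule prob_no_point_in_region[OF m orth sum join])
  finally show ?thesis .
qed

text \<open>Rounding coordinates up stays in the region, so a union bound over integer points suffices.\<close>
lemma prob_region_min_less:
  assumes a: "0 \<le> a"
  shows "prob {\<omega> \<in> space M. region_min (sample \<omega>) n < a} \<le>
           (a + 2) ^ CARD('d) * exp (- (real n * exp (- (a + CARD('d)))))"
proof -
  define v :: "('d \<Rightarrow> nat) \<Rightarrow> real^'d" where "v f = (\<chi> j. real (f j))" for f
  \<comment> \<open>Rounding up adds at most 1 per coordinate, hence at most \<open>CARD('d)\<close>
    to the sum.\<close>
  define F where "F = {f \<in> UNIV \<rightarrow>\<^sub>E {..nat \<lceil>a\<rceil>}. coord_sum (v f) \<le> a + CARD('d)}"
  have "finite F" unfolding F_def
    by (rule finite_subset[of _ "UNIV \<rightarrow>\<^sub>E {..nat \<lceil>a\<rceil>}"]) (auto intro: finite_PiE)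
  have "{\<omega> \<in> space M. region_min (sample \<omega>) n < a} \<subseteq> (\<Union>f\<in>F. {\<omega> \<in> space M. v f \<in> record_region (sample \<omega>) n})"
  proof
    fix \<omega> assume "\<omega> \<in> {\<omega> \<in> space M. region_min (sample \<omega>) n < a}"
    then obtain x where x: "\<omega> \<in> space M" "x \<in> record_region (sample \<omega>) n" "coord_sum x < a"
      by (auto simp: region_min_less_iff)
    have o: "x \<in> orthant" using x record_region_subset_orthant by auto
    define f where "f j = nat \<lceil>x $ j\<rceil>" for j
    have f: "x $ j \<le> real (f j)" "real (f j) \<le> x $ j + 1" for j
      using o by (auto simp: f_def orthant_def)
    have "f j \<le> nat \<lceil>a\<rceil>" for j
      unfolding f_def using component_le_coord_sum[OF o, of j] x(3) by (intro nat_mono ceiling_mono) auto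
    moreover have "coord_sum (v f) \<le> a + CARD('d)"
    proof -
      have "coord_sum (v f) \<le> (\<Sum>j\<in>UNIV. x $ j + 1)"
        unfolding coord_sum_def v_def using f by (intro sum_mono) auto
      also have "\<dots> = coord_sum x + CARD('d)" by (simp add: coord_sum_def sum.distrib)
      finally show ?thesis using x by simp
    qed
    ultimately have "f \<in> F" by (auto simp: F_def)
    moreover have "v f \<in> record_region (sample \<omega>) n"
      using record_region_upward_closed[OF x(2), of "v f"] f by (auto simp: v_def)
    ultimately show "\<omega> \<in> (\<Union>f\<in>F. {\<omega> \<in> space M. v f \<in> record_region (sample \<omega>) n})" using x by auto
  qed
  then have "prob {\<omega> \<in> space M. region_min (sample \<omega>) n < a} \<le>
      prob (\<Union>f\<in>F. {\<omega> \<in> space M. v f \<in> record_region (sample \<omega>) n})"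
    using \<open>finite F\<close> record_region_event by (intro finite_measure_mono sets.finite_UN) auto
  also have "\<dots> \<le> (\<Sum>f\<in>F. prob {\<omega> \<in> space M. v f \<in> record_region (sample \<omega>) n})"
    using \<open>finite F\<close> record_region_event by (intro finite_measure_subadditive_finite) auto
  also have "\<dots> \<le> (\<Sum>f\<in>F. exp (- (real n * exp (- (a + CARD('d))))))"
  proof (rule sum_mono)
    fix f assume "f \<in> F"
    have "prob {\<omega> \<in> space M. v f \<in> record_region (sample \<omega>) n} \<le> exp (- (real n * exp (- coord_sum (v f))))"
      by (rule prob_record_region_le) (simp add: orthant_def v_def)
    also have "\<dots> \<le> exp (- (real n * exp (- (a + CARD('d)))))"
      using \<open>f \<in> F\<close> by (auto simp: F_def intro!: mult_left_mono)
    finally show "prob {\<omega> \<in> space M. v f \<in> record_region (sample \<omega>) n} \<le>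
      exp (- (real n * exp (- (a + CARD('d)))))" .
  qed
  also have "\<dots> = real (card F) * exp (- (real n * exp (- (a + CARD('d)))))" by simp
  also have "\<dots> \<le> (a + 2) ^ CARD('d) * exp (- (real n * exp (- (a + CARD('d)))))"
  proof (rule mult_right_mono)
    have "card F \<le> card ((UNIV :: 'd set) \<rightarrow>\<^sub>E {..nat \<lceil>a\<rceil>})"
      by (rule card_mono) (auto simp: F_def intro: finite_PiE)
    also have "\<dots> = Suc (nat \<lceil>a\<rceil>) ^ CARD('d)" by (simp add: card_PiE)
    finally have "real (card F) \<le> real (Suc (nat \<lceil>a\<rceil>)) ^ CARD('d)"
      by (metis of_nat_le_iff of_nat_power)
    also have "\<dots> \<le> (a + 2) ^ CARD('d)"
      using a by (intro power_mono) (auto, linarith)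
    finally show "real (card F) \<le> (a + 2) ^ CARD('d)" .
  qed simp
  finally show ?thesis .
qed

end

section \<open>Dyadic times and asymptotics of the tails\<close>

text \<open>Used with \<open>u = ln n\<close>: then \<open>exp u\<close> is the sample size, and
  \<open>n\<close> times an exponential tail at \<open>ln n + c ln ln n\<close> becomes a power of
  \<open>ln n\<close>.\<close>

lemma exp_mult_exp_minus_shift: "u > 0 \<Longrightarrow> exp u * exp (- (u + c * ln u)) = u powr (- c)" for u :: real
  by (simp add: powr_def exp_add[symmetric])

lemma exp_mult_erlang_tail:
  "u > 0 \<Longrightarrow> exp u * erlang_tail d (u + c * ln u) = u powr (- c) * (\<Sum>k<d. (u + c * ln u) ^ k / fact k)"
  unfolding erlang_tail_def mult.assoc[symmetric] by (simp only: exp_mult_exp_minus_shift)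

text \<open>Eventually \<open>u + c * ln u\<close> lies between 1 and \<open>2 * u\<close>, so each
  of the \<open>d\<close> terms of the tail sum is at most \<open>(2 * u) ^ (d - 1)\<close>.\<close>

lemma erlang_tail_upper:
  "\<forall>\<^sub>F u in at_top. exp u * erlang_tail d (u + c * ln u) \<le> (real d * 2 ^ (d - 1)) * u powr (real d - 1 - c)"
proof -
  have "\<forall>\<^sub>F u::real in at_top. 1 \<le> u + c * ln u" by real_asymp
  moreover have "\<forall>\<^sub>F u::real in at_top. u + c * ln u \<le> 2 * u" by real_asymp
  moreover have "\<forall>\<^sub>F u::real in at_top. 0 < u" by (rule eventually_gt_at_top)
  ultimately show ?thesis
  proof eventually_elim
    case (elim u)
    let ?a = "u + c * ln u"
    have "(\<Sum>k<d. ?a ^ k / fact k) \<le> (\<Sum>k<d. (2 * u) ^ (d - 1))"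
    proof (rule sum_mono)
      fix k assume k: "k \<in> {..<d}"
      have "?a ^ k / fact k \<le> ?a ^ k / 1"
        using elim by (intro divide_left_mono) (auto simp: fact_ge_1)
      also have "\<dots> \<le> ?a ^ (d - 1)" using elim k by (auto intro!: power_increasing)
      also have "\<dots> \<le> (2 * u) ^ (d - 1)" using elim by (intro power_mono) auto
      finally show "?a ^ k / fact k \<le> (2 * u) ^ (d - 1)" .
    qed
    also have "\<dots> = real d * 2 ^ (d - 1) * u ^ (d - 1)" by (simp add: power_mult_distrib)
    finally have "u powr (- c) * (\<Sum>k<d. ?a ^ k / fact k) \<le> u powr (- c) * (real d * 2 ^ (d - 1) * u ^ (d - 1))"
      by (rule mult_left_mono) simp
    also have "\<dots> = (real d * 2 ^ (d - 1)) * (u powr (- c) * u powr (real d - 1))"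
    \<comment> \<open>For \<open>d = 0\<close> the truncated \<open>d - 1\<close> differs from
      \<open>real d - 1\<close>, but the factor \<open>real d\<close> makes both sides
      vanish.\<close>
    proof (cases "d = 0")
      case False
      then have "u ^ (d - 1) = u powr (real d - 1)"
        using elim by (simp add: powr_realpow[symmetric] of_nat_diff)
      then show ?thesis by simp
    qed simp
    also have "u powr (- c) * u powr (real d - 1) = u powr (real d - 1 - c)"
      by (simp add: powr_add[symmetric])
    finally show ?case using elim by (simp only: exp_mult_erlang_tail)
  qed
qed

text \<open>Only the top term \<open>k = d - 1\<close> is kept, with \<open>u + c * ln u\<close>
  eventually at least \<open>u / 2\<close>.\<close>

lemma erlang_tail_lower:
  assumes d: "d \<ge> 1"
  shows "\<forall>\<^sub>F u in at_top. u powr (real d - 1 - c) / (2 ^ (d - 1) * fact (d - 1)) \<le> exp u * erlang_tail d (u + c * ln u)"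
proof -
  have "\<forall>\<^sub>F u::real in at_top. u / 2 \<le> u + c * ln u" by real_asymp
  moreover have "\<forall>\<^sub>F u::real in at_top. 0 < u" by (rule eventually_gt_at_top)
  ultimately show ?thesis
  proof eventually_elim
    case (elim u)
    let ?a = "u + c * ln u"
    have a: "0 \<le> ?a" using elim by linarith
    have "u ^ (d - 1) = u powr (real d - 1)"
      using elim d by (simp add: powr_realpow[symmetric] of_nat_diff)
    then have "u powr (real d - 1 - c) = u powr (- c) * u ^ (d - 1)"
      by (simp add: powr_add[symmetric])
    then have "u powr (real d - 1 - c) / (2 ^ (d - 1) * fact (d - 1)) = u powr (- c) * ((u / 2) ^ (d - 1) / fact (d - 1))"
      by (simp add: power_divide)
    also have "\<dots> \<le> u powr (- c) * (?a ^ (d - 1) / fact (d - 1))"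
      using elim by (intro mult_left_mono divide_right_mono power_mono) auto
    also have "\<dots> \<le> u powr (- c) * (\<Sum>k<d. ?a ^ k / fact k)"
      using d a by (intro mult_left_mono member_le_sum[of "d - 1" "{..<d}" "\<lambda>k. ?a ^ k / fact k"]) auto
    finally show ?case using elim by (simp only: exp_mult_erlang_tail)
  qed
qed

section \<open>Borel-Cantelli tools, along powers of two and from vanishing probabilities\<close>

lemma filterlim_ln_nat: "filterlim (\<lambda>n. ln (real n)) at_top sequentially"
  by real_asymp

lemma (in prob_space) prob_tendsto_0_of_bigo:
  assumes "(\<lambda>n. prob (A n)) \<in> O(\<lambda>n. ln (real n) powr (- p))" "p > 0"
  shows "(\<lambda>n. prob (A n)) \<longlonglongrightarrow> 0"
proof -
  obtain C where "\<forall>\<^sub>F n in sequentially. norm (prob (A n)) \<le> C * norm (ln (real n) powr (- p))"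
    using assms(1) by (elim landau_o.bigE)
  moreover have "(\<lambda>n. C * norm (ln (real n) powr (- p))) \<longlonglongrightarrow> 0"
  proof (intro tendsto_mult_right_zero tendsto_norm_zero)
    show "(\<lambda>n. ln (real n) powr (- p)) \<longlonglongrightarrow> 0"
      using assms(2) by real_asymp
  qed
  ultimately show ?thesis by (rule Lim_null_comparison)
qed

text \<open>Since \<open>ln (2 ^ k)\<close> is \<open>k * ln 2\<close>, the bound at time
  \<open>2 ^ k\<close> is of order \<open>k powr (- p)\<close>, summable for \<open>p > 1\<close>,
  and the first Borel-Cantelli lemma applies.\<close>

lemma (in prob_space) AE_eventually_dyadic:
  assumes A: "\<And>n. A n \<in> events"
    and "(\<lambda>n. prob (A n)) \<in> O(\<lambda>n. ln (real n) powr (- p))" "p > 1"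
  shows "AE \<omega> in M. \<forall>\<^sub>F k in sequentially. \<omega> \<notin> A (2 ^ k)"
proof -
  have lim: "filterlim (\<lambda>k::nat. 2 ^ k :: nat) sequentially sequentially"
    by real_asymp
  have "(\<lambda>k. prob (A (2 ^ k))) \<in> O(\<lambda>k. ln (real (2 ^ k)) powr (- p))"
    by (rule landau_o.big.compose[OF assms(2) lim])
  also have "(\<lambda>k. ln (real (2 ^ k)) powr (- p)) = (\<lambda>k. ln 2 powr (- p) * real k powr (- p))"
    by (simp add: ln_realpow powr_mult mult.commute)
  finally have "(\<lambda>k. prob (A (2 ^ k))) \<in> O(\<lambda>k. ln 2 powr (- p) * real k powr (- p))" .
  moreover have "summable (\<lambda>k. norm (ln 2 powr (- p) * real k powr (- p)))"
    using assms(3) by (auto intro!: summable_mult simp: summable_real_powr_iff abs_mult)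
  ultimately have "summable (\<lambda>k. prob (A (2 ^ k)))"
    by (rule summable_comparison_test_bigo[rotated])
  then have "AE \<omega> in M. \<forall>\<^sub>F k in sequentially. \<omega> \<in> space M - A (2 ^ k)"
    using A by (intro borel_cantelli_AE1) (auto simp: less_top[symmetric])
  then show ?thesis by eventually_elim (auto elim: eventually_mono)
qed

text \<open>The intersection of all \<open>A n\<close> with \<open>n\<close> at least
  \<open>N\<close> has probability at most each \<open>prob (A n)\<close>, hence 0. It is used to
  turn convergence in probability into closeness infinitely often.\<close>

lemma (in prob_space) AE_frequently_not_of_prob_tendsto_0:
  assumes A: "\<And>n. A n \<in> events" and lim: "(\<lambda>n. prob (A n)) \<longlonglongrightarrow> 0"
  shows "AE \<omega> in M. \<exists>\<^sub>F n in sequentially. \<omega> \<notin> A n"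
proof -
  have "AE \<omega> in M. \<exists>n\<ge>N. \<omega> \<notin> A n" for N
  proof -
    define B where "B = (\<Inter>n\<in>{N..}. A n)"
    have B: "B \<in> events" unfolding B_def using A by (intro sets.countable_INT') auto
    have "prob B \<le> prob (A n)" if "n \<ge> N" for n
      using that A by (intro finite_measure_mono) (auto simp: B_def)
    then have "prob B \<le> 0"
      by (intro tendsto_lowerbound[OF lim]) (auto simp: eventually_sequentially)
    then have "prob B = 0" by (simp add: measure_le_0_iff)
    then have "AE \<omega> in M. \<omega> \<notin> B"
      using B by (simp add: prob_eq_0)
    then show ?thesis by eventually_elim (auto simp: B_def)
  qed
  then show ?thesis by (simp add: frequently_sequentially AE_all_countable)
qed

text \<open>Compare \<open>n\<close> with a power of two between \<open>n\<close> and
  \<open>2 * n\<close>. This changes \<open>ln n\<close> by at most \<open>ln 2\<close> and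
  \<open>ln ln n\<close> by a vanishing amount; both are absorbed by
  \<open>(c' - c) * ln (ln n)\<close>. The absolute value of \<open>c\<close> covers both
  signs.\<close>

lemma dyadic_upper:
  fixes G :: "nat \<Rightarrow> real"
  assumes mono: "\<And>m n. 1 \<le> m \<Longrightarrow> m \<le> n \<Longrightarrow> G m \<le> G n"
    and dyadic: "\<forall>\<^sub>F k in sequentially. G (2 ^ k) \<le> ln (real (2 ^ k)) + c * ln (ln (real (2 ^ k)))"
    and "c < c'"
  shows "\<forall>\<^sub>F n in sequentially. G n \<le> ln (real n) + c' * ln (ln (real n))"
proof -
  obtain K where K: "\<And>k. k \<ge> K \<Longrightarrow> G (2 ^ k) \<le> ln (real (2 ^ k)) + c * ln (ln (real (2 ^ k)))"
    using dyadic by (auto simp: eventually_sequentially)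
  have gap: "\<forall>\<^sub>F n in sequentially. ln 2 + b * (ln (ln (2 * real n)) - ln (ln (real n))) \<le> e * ln (ln (real n))"
    if "e > 0" for b e :: real
    using that by real_asymp
  have "\<forall>\<^sub>F n in sequentially. ln 2 + \<bar>c\<bar> * (ln (ln (2 * real n)) - ln (ln (real n))) \<le> (c' - c) * ln (ln (real n))"
    using assms(3) by (intro gap) auto
  moreover have "\<forall>\<^sub>F n::nat in sequentially. n \<ge> 3" by (rule eventually_ge_at_top)
  moreover have "\<forall>\<^sub>F n::nat in sequentially. n \<ge> 2 ^ K" by (rule eventually_ge_at_top)
  ultimately show ?thesis
  proof eventually_elim
    case (elim n)
    define k where "k = Suc (floor_log n)"
    define N where "N = real (2 ^ k)"
    have k1: "n \<le> 2 ^ k" using floor_log_exp2_ge[of n] by (simp add: k_def)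
    have k2: "N \<le> 2 * real n"
    proof -
      have "2 ^ floor_log n \<le> n" using elim by (intro floor_log_exp2_le) auto
      then have "2 ^ k \<le> 2 * n" by (simp add: k_def)
      then show ?thesis unfolding N_def by (metis of_nat_le_iff of_nat_mult of_nat_numeral)
    qed
    have k3: "real n \<le> N" unfolding N_def using k1 by (rule of_nat_mono)
    have "K \<le> k" using floor_log_le_iff[OF elim(3)] by (simp add: k_def)
    have n3: "real n \<ge> 3" using elim by simp
    have l0: "0 < ln (real n)" using n3 by simp
    have l1: "ln (real n) \<le> ln N" "ln N \<le> ln (2 * real n)" using k2 k3 n3 by auto
    have ll: "ln (ln (real n)) \<le> ln (ln N)" "ln (ln N) \<le> ln (ln (2 * real n))"
      using l0 l1 by auto
    have "G n \<le> G (2 ^ k)" using k1 elim by (intro mono) auto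
    also have "\<dots> \<le> ln N + c * ln (ln N)" unfolding N_def using \<open>K \<le> k\<close> by (rule K)
    also have "\<dots> = ln N + c * ln (ln (real n)) + c * (ln (ln N) - ln (ln (real n)))"
      by (simp add: algebra_simps)
    also have "c * (ln (ln N) - ln (ln (real n))) \<le> \<bar>c\<bar> * (ln (ln (2 * real n)) - ln (ln (real n)))"
      using ll by (intro mult_mono) auto
    also have "ln N \<le> ln 2 + ln (real n)" using l1 n3 by (simp add: ln_mult)
    finally show ?case using elim(1) by (simp add: algebra_simps)
  qed
qed

text \<open>Mirror image of \<open>dyadic_upper\<close>, with the power of two taken between
  \<open>n / 2\<close> and \<open>n\<close>.\<close>

lemma dyadic_lower:
  fixes G :: "nat \<Rightarrow> real"
  assumes mono: "\<And>m n. 1 \<le> m \<Longrightarrow> m \<le> n \<Longrightarrow> G m \<le> G n"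
    and dyadic: "\<forall>\<^sub>F k in sequentially. ln (real (2 ^ k)) + c * ln (ln (real (2 ^ k))) \<le> G (2 ^ k)"
    and "c' < c"
  shows "\<forall>\<^sub>F n in sequentially. ln (real n) + c' * ln (ln (real n)) \<le> G n"
proof -
  obtain K where K: "\<And>k. k \<ge> K \<Longrightarrow> ln (real (2 ^ k)) + c * ln (ln (real (2 ^ k))) \<le> G (2 ^ k)"
    using dyadic by (auto simp: eventually_sequentially)
  have gap: "\<forall>\<^sub>F n in sequentially. ln 2 + b * (ln (ln (real n)) - ln (ln (real n / 2))) \<le> e * ln (ln (real n))"
    if "e > 0" for b e :: real
    using that by real_asymp
  have "\<forall>\<^sub>F n in sequentially. ln 2 + \<bar>c\<bar> * (ln (ln (real n)) - ln (ln (real n / 2))) \<le> (c - c') * ln (ln (real n))"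
    using assms(3) by (intro gap) auto
  moreover have "\<forall>\<^sub>F n::nat in sequentially. n \<ge> 3" by (rule eventually_ge_at_top)
  moreover have "\<forall>\<^sub>F n::nat in sequentially. n \<ge> 2 ^ K" by (rule eventually_ge_at_top)
  ultimately show ?thesis
  proof eventually_elim
    case (elim n)
    define k where "k = floor_log n"
    define N where "N = real (2 ^ k)"
    have k1: "2 ^ k \<le> n" unfolding k_def using elim by (intro floor_log_exp2_le) auto
    have k2: "real n / 2 \<le> N"
    proof -
      have "n \<le> 2 * 2 ^ k" unfolding k_def by (rule floor_log_exp2_ge)
      then have "real n \<le> 2 * N" unfolding N_def by (metis of_nat_le_iff of_nat_mult of_nat_numeral)
      then show ?thesis by simp
    qed
    have k3: "N \<le> real n" unfolding N_def using k1 by (rule of_nat_mono)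
    have "K \<le> k" using floor_log_le_iff[OF elim(3)] by (simp add: k_def)
    have n3: "real n \<ge> 3" using elim by simp
    \<comment> \<open>From \<open>n\<close> at least 3, \<open>n / 2\<close> exceeds 1, so the
      iterated logarithms below are those of positive numbers and are monotone.\<close>
    have l0: "0 < ln (real n / 2)" using n3 by simp
    have l1: "ln (real n / 2) \<le> ln N" "ln N \<le> ln (real n)" using k2 k3 n3 by auto
    have ll: "ln (ln (real n / 2)) \<le> ln (ln N)" "ln (ln N) \<le> ln (ln (real n))"
      using l0 l1 by auto
    have "c * (ln (ln (real n)) - ln (ln N)) \<le> \<bar>c\<bar> * (ln (ln (real n)) - ln (ln (real n / 2)))"
      using ll by (intro mult_mono) auto
    moreover have "ln (real n) - ln 2 \<le> ln N" using l1 n3 by (simp add: ln_div)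
    ultimately have "ln (real n) + c' * ln (ln (real n)) \<le> ln N + c * ln (ln N)"
      using elim(1) by (simp add: algebra_simps)
    also have "\<dots> \<le> G (2 ^ k)" unfolding N_def using \<open>K \<le> k\<close> by (rule K)
    also have "\<dots> \<le> G n" using k1 by (intro mono) auto
    finally show ?case .
  qed
qed

lemma Liminf_eqI_frequently:
  fixes f :: "nat \<Rightarrow> real"
  assumes "\<And>e. e > 0 \<Longrightarrow> \<forall>\<^sub>F n in sequentially. L - e \<le> f n"
    and "\<And>e. e > 0 \<Longrightarrow> \<exists>\<^sub>F n in sequentially. f n \<le> L + e"
  shows "liminf (\<lambda>n. ereal (f n)) = ereal L"
proof (rule antisym)
  show "ereal L \<le> liminf (\<lambda>n. ereal (f n))"
  proof (rule ccontr)
    assume "\<not> ?thesis"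
    then obtain y where y: "liminf (\<lambda>n. ereal (f n)) < ereal y" "ereal y < ereal L"
      using ereal_dense2[of "liminf (\<lambda>n. ereal (f n))" "ereal L"] by (auto simp: not_le)
    have "ereal y \<le> liminf (\<lambda>n. ereal (f n))"
      using assms(1)[of "L - y"] y by (intro Liminf_bounded) simp
    with y show False by simp
  qed
  show "liminf (\<lambda>n. ereal (f n)) \<le> ereal L"
  proof (rule ccontr)
    assume "\<not> ?thesis"
    then obtain y where y: "ereal L < ereal y" "ereal y < liminf (\<lambda>n. ereal (f n))"
      using ereal_dense2[of "ereal L"] by (auto simp: not_le)
    have "\<forall>\<^sub>F n in sequentially. y < f n"
      using less_LiminfD[OF y(2)] by simp
    moreover have "\<exists>\<^sub>F n in sequentially. f n \<le> y"
      using assms(2)[of "y - L"] y by simp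
    ultimately show False by (auto simp: frequently_def not_le elim: eventually_mono)
  qed
qed

lemma Limsup_eqI_frequently:
  fixes f :: "nat \<Rightarrow> real"
  assumes "\<And>e. e > 0 \<Longrightarrow> \<forall>\<^sub>F n in sequentially. f n \<le> L + e"
    and "\<And>e. e > 0 \<Longrightarrow> \<exists>\<^sub>F n in sequentially. L - e \<le> f n"
  shows "limsup (\<lambda>n. ereal (f n)) = ereal L"
proof -
  have "liminf (\<lambda>n. ereal (- f n)) = ereal (- L)"
    by (rule Liminf_eqI_frequently) (use assms in \<open>auto elim!: eventually_mono frequently_elim1 simp: algebra_simps\<close>)
  then have "- limsup (\<lambda>n. ereal (f n)) = - ereal L"
    by (simp add: ereal_Liminf_uminus[symmetric])
  then show ?thesis by (simp only: ereal_uminus_eq_iff)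
qed

section \<open>Tail probabilities as powers of ln n\<close>

context exponential_sample
begin

abbreviation threshold :: "real \<Rightarrow> nat \<Rightarrow> real" where
  "threshold c n \<equiv> ln (real n) + c * ln (ln (real n))"

lemma eventually_threshold_nonneg: "\<forall>\<^sub>F n in sequentially. 0 \<le> threshold c n"
  by real_asymp

text \<open>Union bound with the Gamma tail. The exponent is negative for \<open>c > d - 1\<close>,
  which gives the limit in probability, but below -1 only for \<open>c > d\<close>, which is what
  the dyadic Borel-Cantelli argument needs.\<close>

lemma sum_max_upper_tail:
  "(\<lambda>n. prob {\<omega> \<in> space M. threshold c n < sum_max (sample \<omega>) n}) \<in>
     O(\<lambda>n. ln (real n) powr (- (c - (real CARD('d) - 1))))"
proof (rule landau_o.bigI)
  let ?K = "real CARD('d) * 2 ^ (CARD('d) - 1)"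
  show "?K > 0" by simp
  show "\<forall>\<^sub>F n in sequentially. norm (prob {\<omega> \<in> space M. threshold c n < sum_max (sample \<omega>) n})
      \<le> ?K * norm (ln (real n) powr (- (c - (real CARD('d) - 1))))"
    using eventually_threshold_nonneg[of c] eventually_ge_at_top[of 1]
      eventually_compose_filterlim[OF erlang_tail_upper[of "CARD('d)" c] filterlim_ln_nat]
  proof eventually_elim
    case (elim n)
    then have "prob {\<omega> \<in> space M. threshold c n < sum_max (sample \<omega>) n} \<le> real n * erlang_tail CARD('d) (threshold c n)"
      by (intro prob_sum_max_gt) auto
    also have "\<dots> \<le> ?K * ln (real n) powr (real CARD('d) - 1 - c)"
      using elim by simp
    finally show ?case by (simp add: algebra_simps)
  qed
qed

text \<open>The probability is at most \<open>exp (- (K * ln n powr p))\<close> with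
  \<open>p > 0\<close>, smaller than any power of \<open>ln n\<close>. The exponent 2 is just a
  convenient value above 1.\<close>

lemma sum_max_lower_tail:
  assumes c: "c < real CARD('d) - 1"
  shows "(\<lambda>n. prob {\<omega> \<in> space M. sum_max (sample \<omega>) n < threshold c n}) \<in> O(\<lambda>n. ln (real n) powr (- 2))"
proof -
  have card_ge_1: "1 \<le> CARD('d)" by (simp add: Suc_le_eq)
  define K :: real where "K = 1 / (2 ^ (CARD('d) - 1) * fact (CARD('d) - 1))"
  define p where "p = real CARD('d) - 1 - c"
  have Kp: "K > 0" "p > 0" using c by (auto simp: K_def p_def)
  have "(\<lambda>n. prob {\<omega> \<in> space M. sum_max (sample \<omega>) n < threshold c n}) \<in> O(\<lambda>n. exp (- (K * ln (real n) powr p)))"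
  proof (rule landau_o.bigI)
    show "(1::real) > 0" by simp
    show "\<forall>\<^sub>F n in sequentially. norm (prob {\<omega> \<in> space M. sum_max (sample \<omega>) n < threshold c n})
      \<le> 1 * norm (exp (- (K * ln (real n) powr p)))"
      using eventually_threshold_nonneg[of c] eventually_ge_at_top[of 1]
        eventually_compose_filterlim[OF erlang_tail_lower[OF card_ge_1, of c] filterlim_ln_nat]
    proof eventually_elim
      case (elim n)
      have "prob {\<omega> \<in> space M. sum_max (sample \<omega>) n < threshold c n} \<le> prob {\<omega> \<in> space M. sum_max (sample \<omega>) n \<le> threshold c n}"
        by (intro finite_measure_mono) auto
      also have "\<dots> \<le> exp (- (real n * erlang_tail CARD('d) (threshold c n)))"
        using elim by (intro prob_sum_max_le) auto
      also have "\<dots> \<le> exp (- (K * ln (real n) powr p))"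
        using elim by (simp add: K_def p_def)
      finally show ?case by simp
    qed
  qed
  also have "(\<lambda>n. exp (- (K * ln (real n) powr p))) \<in> O(\<lambda>n. ln (real n) powr (- 2))"
  proof -
    have "(\<lambda>u. exp (- (K * u powr p))) \<in> O(\<lambda>u. u powr (- 2))"
      using Kp by real_asymp
    then show ?thesis by (rule landau_o.big.compose[OF _ filterlim_ln_nat])
  qed
  finally show ?thesis .
qed

text \<open>At the threshold, \<open>n\<close> times the domination probability of one test point is
  \<open>ln n powr (- e)\<close>, so \<open>m\<close> points give exponent \<open>m * e\<close>. The
  term for shared dominators carries a further \<open>exp (- threshold e n / m)\<close>, about
  \<open>n\<close> to the power \<open>-1 / m\<close>, and is negligible.\<close>

lemma region_min_upper_tail:
  fixes j\<^sub>1 j\<^sub>2 :: 'd and m :: nat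
  assumes m: "m \<ge> 1" and e: "e > 0" and j: "m = 1 \<or> j\<^sub>1 \<noteq> j\<^sub>2"
  shows "(\<lambda>n. prob {\<omega> \<in> space M. threshold e n < region_min (sample \<omega>) n}) \<in> O(\<lambda>n. ln (real n) powr (- (real m * e)))"
proof -
  let ?b = "\<lambda>u::real. u powr (- (real m * e)) + real m ^ 2 * (u powr (- e) * exp (- ((u + e * ln u) / real m)))"
  have "(\<lambda>n. prob {\<omega> \<in> space M. threshold e n < region_min (sample \<omega>) n}) \<in> O(\<lambda>n. ?b (ln (real n)))"
  proof (rule landau_o.bigI)
    show "(1::real) > 0" by simp
    show "\<forall>\<^sub>F n in sequentially. norm (prob {\<omega> \<in> space M. threshold e n < region_min (sample \<omega>) n})
      \<le> 1 * norm (?b (ln (real n)))"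
      using eventually_threshold_nonneg[of e] eventually_ge_at_top[of 2]
    proof eventually_elim
      case (elim n)
      let ?u = "ln (real n)"
      have u: "?u > 0" "exp ?u = real n" using elim by auto
      have *: "real n * exp (- threshold e n) = ?u powr (- e)"
        using exp_mult_exp_minus_shift[of ?u e] u by simp
      have "real n * exp (- (threshold e n + threshold e n / real m)) = ?u powr (- e) * exp (- (threshold e n / real m))"
        unfolding *[symmetric] by (simp add: exp_add[symmetric] mult.assoc)
      moreover have "(?u powr (- e)) ^ m = ?u powr (- (real m * e))"
        using u by (simp add: powr_realpow[symmetric] powr_powr mult.commute)
      ultimately show ?case
        using prob_region_min_gt[OF m elim(1) j, of n] * by simp
    qed
  qed
  also have "(\<lambda>n. ?b (ln (real n))) \<in> O(\<lambda>n. ln (real n) powr (- (real m * e)))"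
  proof -
    have "?b \<in> O(\<lambda>u. u powr (- (real m * e)))"
    proof (intro sum_in_bigo)
      have "(\<lambda>u. u powr (- e) * exp (- ((u + e * ln u) / real m))) \<in> O(\<lambda>u. u powr (- (real m * e)))"
        using e m by real_asymp
      then show "(\<lambda>u. real m ^ 2 * (u powr (- e) * exp (- ((u + e * ln u) / real m)))) \<in> O(\<lambda>u. u powr (- (real m * e)))"
        by simp
    qed simp
    then show ?thesis by (rule landau_o.big.compose[OF _ filterlim_ln_nat])
  qed
  finally show ?thesis .
qed

text \<open>The number of integer points grows only like a power of \<open>ln n\<close>, while each
  lies in the region with probability at most \<open>exp (- (K * ln n powr e))\<close>.\<close>

lemma region_min_lower_tail:
  assumes e: "e > 0"
  shows "(\<lambda>n. prob {\<omega> \<in> space M. region_min (sample \<omega>) n < threshold (- e) n}) \<in> O(\<lambda>n. ln (real n) powr (- 2))"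
proof -
  define d where "d = real CARD('d)"
  \<comment> \<open>The cost of rounding: it raises the sum by up to \<open>d\<close>, which shrinks
    the domination probability by at most \<open>exp (- d)\<close>.\<close>
  define K where "K = exp (- d)"
  let ?b = "\<lambda>u::real. 2 powr d * u powr d * exp (- (K * u powr e))"
  have "(\<lambda>n. prob {\<omega> \<in> space M. region_min (sample \<omega>) n < threshold (- e) n}) \<in> O(\<lambda>n. ?b (ln (real n)))"
  proof (rule landau_o.bigI)
    show "(1::real) > 0" by simp
    have "\<forall>\<^sub>F n in sequentially. threshold (- e) n + 2 \<le> 2 * ln (real n)" by real_asymp
    with eventually_threshold_nonneg[of "- e"] eventually_ge_at_top[of 2]
    show "\<forall>\<^sub>F n in sequentially. norm (prob {\<omega> \<in> space M. region_min (sample \<omega>) n < threshold (- e) n})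
      \<le> 1 * norm (?b (ln (real n)))"
    proof eventually_elim
      case (elim n)
      let ?u = "ln (real n)"
      have u: "?u > 0" "exp ?u = real n" using elim by auto
      have *: "real n * exp (- threshold (- e) n) = ?u powr e"
        using exp_mult_exp_minus_shift[of ?u "- e"] u by simp
      have "real n * exp (- (threshold (- e) n + d)) = K * ?u powr e"
        unfolding *[symmetric] K_def by (simp add: exp_add[symmetric] mult.left_commute)
      then have "prob {\<omega> \<in> space M. region_min (sample \<omega>) n < threshold (- e) n}
          \<le> (threshold (- e) n + 2) ^ CARD('d) * exp (- (K * ?u powr e))"
        using prob_region_min_less[OF elim(1), of n] by (simp add: d_def)
      also have "(threshold (- e) n + 2) ^ CARD('d) \<le> (2 * ?u) ^ CARD('d)"
        using elim by (intro power_mono) auto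
      also have "(2 * ?u) ^ CARD('d) = 2 powr d * ?u powr d"
        using u by (simp add: d_def powr_realpow power_mult_distrib)
      finally show ?case by simp
    qed
  qed
  also have "(\<lambda>n. ?b (ln (real n))) \<in> O(\<lambda>n. ln (real n) powr (- 2))"
  proof -
    have "K > 0" by (simp add: K_def)
    then have "?b \<in> O(\<lambda>u. u powr (- 2))" using e by real_asymp
    then show ?thesis by (rule landau_o.big.compose[OF _ filterlim_ln_nat])
  qed
  finally show ?thesis .
qed

end

section \<open>Almost sure and in-probability limits\<close>

text \<open>The difference is the logarithm of a ratio; the bounds \<open>ln x\<close> at most
  \<open>x - 1\<close> and \<open>ln (1 + x)\<close> at most \<open>x\<close> finish it.\<close>

lemma ln_ln_Suc_diff_le:
  assumes "n \<ge> 2"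
  shows "ln (ln (real (Suc n))) - ln (ln (real n)) \<le> 1 / (real n * ln (real n))"
proof -
  have l: "0 < ln (real n)" "0 < ln (real (Suc n))" using assms by auto
  have "ln (ln (real (Suc n))) - ln (ln (real n)) = ln (ln (real (Suc n)) / ln (real n))"
    using l by (simp add: ln_div)
  also have "\<dots> \<le> ln (real (Suc n)) / ln (real n) - 1"
    using l by (intro ln_le_minus_one) simp
  also have "\<dots> = (ln (real (Suc n)) - ln (real n)) / ln (real n)"
    using l by (simp add: diff_divide_distrib)
  also have "ln (real (Suc n)) - ln (real n) = ln (1 + 1 / real n)"
  proof -
    have "1 + 1 / real n = real (Suc n) / real n" using assms by (simp add: field_simps)
    then show ?thesis using assms by (simp add: ln_div)
  qed
  also have "\<dots> / ln (real n) \<le> (1 / real n) / ln (real n)"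
    using l assms by (intro divide_right_mono ln_add_one_self_le_self) auto
  finally show ?thesis by simp
qed

text \<open>Telescoping; this quantifies the divergence of the series of
  \<open>1 / (n ln n)\<close>.\<close>

lemma sum_inverse_n_ln_n_ge:
  assumes "2 \<le> N" "N \<le> m"
  shows "ln (ln (real m)) - ln (ln (real N)) \<le> (\<Sum>n=N..<m. 1 / (real n * ln (real n)))"
proof -
  have "ln (ln (real m)) - ln (ln (real N)) = (\<Sum>n=N..<m. ln (ln (real (Suc n))) - ln (ln (real n)))"
    using assms by (subst sum_Suc_diff') auto
  also have "\<dots> \<le> (\<Sum>n=N..<m. 1 / (real n * ln (real n)))"
    using assms by (intro sum_mono ln_ln_Suc_diff_le) auto
  finally show ?thesis .
qed

section \<open>Almost sure bounds for the maximum and the minimum\<close>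

context exponential_sample
begin

lemma AE_sum_max_upper:
  assumes "real CARD('d) < c"
  shows "AE \<omega> in M. \<forall>\<^sub>F n in sequentially. sum_max (sample \<omega>) n \<le> threshold c n"
proof -
  \<comment> \<open>The bound is proved along powers of two with \<open>c'\<close>, leaving a gap
    below \<open>c\<close> for the interpolation; \<open>c' > d\<close> makes the exponent
    \<open>c' - (d - 1)\<close> exceed 1.\<close>
  obtain c' where c': "real CARD('d) < c'" "c' < c" using dense[OF assms] by auto
  have "AE \<omega> in M. \<forall>\<^sub>F k in sequentially. \<omega> \<notin> {\<omega> \<in> space M. threshold c' (2 ^ k) < sum_max (sample \<omega>) (2 ^ k)}"
    by (rule AE_eventually_dyadic[OF _ sum_max_upper_tail]) (use c' in auto)
  with AE_space show ?thesis
  proof eventually_elim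
    case (elim \<omega>)
    then show ?case
      by (intro dyadic_upper[OF sum_max_mono _ c'(2)]) (auto simp: not_less elim: eventually_mono)
  qed
qed

lemma AE_sum_max_lower:
  assumes "c < real CARD('d) - 1"
  shows "AE \<omega> in M. \<forall>\<^sub>F n in sequentially. threshold c n \<le> sum_max (sample \<omega>) n"
proof -
  obtain c' where c': "c < c'" "c' < real CARD('d) - 1" using dense[OF assms] by auto
  have "AE \<omega> in M. \<forall>\<^sub>F k in sequentially. \<omega> \<notin> {\<omega> \<in> space M. sum_max (sample \<omega>) (2 ^ k) < threshold c' (2 ^ k)}"
    by (rule AE_eventually_dyadic[OF _ sum_max_lower_tail[OF c'(2)]]) auto
  with AE_space show ?thesis
  proof eventually_elim
    case (elim \<omega>)
    then show ?case
      by (intro dyadic_lower[OF sum_max_mono _ c'(1)]) (auto simp: not_less elim: eventually_mono)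
  qed
qed

text \<open>Dimension at least two supplies distinct coordinates \<open>j\<^sub>1\<close> and
  \<open>j\<^sub>2\<close>, hence arbitrarily many test points; enough of them raise the decay
  exponent above 1 however small \<open>e\<close> is.\<close>

lemma AE_region_min_upper:
  assumes d: "CARD('d) \<ge> 2" and e: "e > 0"
  shows "AE \<omega> in M. \<forall>\<^sub>F n in sequentially. region_min (sample \<omega>) n \<le> threshold e n"
proof -
  obtain j\<^sub>1 j\<^sub>2 :: 'd where j: "j\<^sub>1 \<noteq> j\<^sub>2"
    using d card_le_Suc0_iff_eq[of "UNIV :: 'd set"] by fastforce
  obtain e' where e': "0 < e'" "e' < e" using dense[OF e] by auto
  obtain m where m: "1 < real m * e'"
    using reals_Archimedean3[OF e'(1)] by auto
  then have "m \<ge> 1" by (cases m) auto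
  have "AE \<omega> in M. \<forall>\<^sub>F k in sequentially. \<omega> \<notin> {\<omega> \<in> space M. threshold e' (2 ^ k) < region_min (sample \<omega>) (2 ^ k)}"
    by (rule AE_eventually_dyadic[OF _ region_min_upper_tail[OF \<open>m \<ge> 1\<close> e'(1) disjI2[OF j]] m]) auto
  with AE_space show ?thesis
  proof eventually_elim
    case (elim \<omega>)
    then show ?case
      by (intro dyadic_upper[OF region_min_mono _ e'(2)]) (auto simp: not_less elim: eventually_mono)
  qed
qed

lemma AE_region_min_lower:
  assumes e: "e > 0"
  shows "AE \<omega> in M. \<forall>\<^sub>F n in sequentially. threshold (- e) n \<le> region_min (sample \<omega>) n"
proof -
  obtain e' where e': "0 < e'" "e' < e" using dense[OF e] by auto
  have "AE \<omega> in M. \<forall>\<^sub>F k in sequentially. \<omega> \<notin> {\<omega> \<in> space M. region_min (sample \<omega>) (2 ^ k) < threshold (- e') (2 ^ k)}"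
    by (rule AE_eventually_dyadic[OF _ region_min_lower_tail[OF e'(1)]]) auto
  with AE_space show ?thesis
  proof eventually_elim
    case (elim \<omega>)
    then show ?case
      by (intro dyadic_lower[OF region_min_mono, where c = "- e'"])
         (use e' in \<open>auto simp: not_less elim: eventually_mono\<close>)
  qed
qed

text \<open>Second Borel-Cantelli argument: the probabilities are of order \<open>1 / (n ln n)\<close>.\<close>
lemma AE_frequently_coord_sum_gt:
  "AE \<omega> in M. \<exists>\<^sub>F n in sequentially. threshold CARD('d) n < coord_sum (X n \<omega>)"
proof -
  define K :: real where "K = 1 / (2 ^ (CARD('d) - 1) * fact (CARD('d) - 1))"
  have K: "K > 0" by (simp add: K_def)
  have card_ge_1: "1 \<le> CARD('d)" by (simp add: Suc_le_eq)
  have "\<forall>\<^sub>F n in sequentially. 0 \<le> threshold CARD('d) n \<and> 2 \<le> n \<and>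
      K * (1 / (real n * ln (real n))) \<le> erlang_tail CARD('d) (threshold CARD('d) n)"
    using eventually_threshold_nonneg[of "real CARD('d)"] eventually_ge_at_top[of 2]
      eventually_compose_filterlim[OF erlang_tail_lower[OF card_ge_1, of "real CARD('d)"] filterlim_ln_nat]
  proof eventually_elim
    case (elim n)
    then have "0 < ln (real n)" by simp
    \<comment> \<open>At \<open>c = d\<close> the exponent \<open>d - 1 - c\<close> equals -1, so
      the tail is at least of order \<open>1 / (n ln n)\<close>.\<close>
    then have "K * (1 / ln (real n)) \<le> real n * erlang_tail CARD('d) (threshold CARD('d) n)"
      using elim by (simp add: K_def powr_minus divide_inverse mult_ac)
    with elim show ?case by (simp add: field_simps)
  qed
  then obtain N\<^sub>0 where N\<^sub>0: "\<And>n. n \<ge> N\<^sub>0 \<Longrightarrow> 0 \<le> threshold CARD('d) n \<and> 2 \<le> n \<and>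
      K * (1 / (real n * ln (real n))) \<le> erlang_tail CARD('d) (threshold CARD('d) n)"
    by (auto simp: eventually_sequentially)
  have *: "AE \<omega> in M. \<exists>n\<ge>N. threshold CARD('d) n < coord_sum (X n \<omega>)" if N: "N \<ge> N\<^sub>0" for N
  proof -
    have N2: "N \<ge> 2" using N\<^sub>0 N by blast
    \<comment> \<open>No exceedance in the window from \<open>N\<close> to \<open>m - 1\<close>. Its
      probability is at most \<open>(ln N / ln m) powr K\<close>, which tends to 0 as
      \<open>m\<close> grows.\<close>
    define A where "A m = {\<omega> \<in> space M. \<forall>n\<in>{N..<m}. coord_sum (X n \<omega>) \<le> threshold CARD('d) n}" for m
    have A: "A m \<in> events" for m
    proof -
      have "A m = {\<omega> \<in> space M. \<forall>n\<in>{N..<m}. X n \<omega> \<in> {x. coord_sum x \<le> threshold CARD('d) n}}"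
        unfolding A_def mem_Collect_eq ..
      also have "\<dots> \<in> events" by (rule X_ball_event) (use N2 in auto)
      finally show ?thesis .
    qed
    have "norm (prob (A m)) \<le> exp (- (K * (ln (ln (real m)) - ln (ln (real N)))))" if "m \<ge> N" for m
    proof -
      have "K * (ln (ln (real m)) - ln (ln (real N))) \<le> K * (\<Sum>n=N..<m. 1 / (real n * ln (real n)))"
        using K N2 that by (intro mult_left_mono sum_inverse_n_ln_n_ge) auto
      also have "\<dots> = (\<Sum>n=N..<m. K * (1 / (real n * ln (real n))))"
        by (simp only: sum_distrib_left)
      also have "\<dots> \<le> (\<Sum>n=N..<m. erlang_tail CARD('d) (threshold CARD('d) n))"
        using N\<^sub>0 N by (intro sum_mono) auto
      moreover have "prob (A m) \<le> exp (- (\<Sum>n=N..<m. erlang_tail CARD('d) (threshold CARD('d) n)))"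
        unfolding A_def
      proof (rule prob_coord_sums_le)
        show "{N..<m} \<subseteq> {1..}" using N2 by auto
        show "0 \<le> threshold CARD('d) n" if "n \<in> {N..<m}" for n using N\<^sub>0[of n] N that by auto
      qed simp
      ultimately show ?thesis by (simp add: order_trans[of "prob (A m)"])
    qed
    then have "\<forall>\<^sub>F m in sequentially. norm (prob (A m)) \<le> exp (- (K * (ln (ln (real m)) - ln (ln (real N)))))"
      by (auto simp: eventually_sequentially)
    moreover have "(\<lambda>m. exp (- (K * (ln (ln (real m)) - b)))) \<longlonglongrightarrow> 0" for b
      using K by real_asymp
    ultimately have "(\<lambda>m. prob (A m)) \<longlonglongrightarrow> 0"
      by (rule Lim_null_comparison)
    from AE_frequently_not_of_prob_tendsto_0[OF A this] AE_space show ?thesis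
    proof eventually_elim
      case (elim \<omega>)
      then obtain m where "\<omega> \<notin> A m" using frequently_ex by blast
      with elim show ?case by (auto simp: A_def not_le)
    qed
  qed
  have "AE \<omega> in M. \<forall>N. N \<ge> N\<^sub>0 \<longrightarrow> (\<exists>n\<ge>N. threshold CARD('d) n < coord_sum (X n \<omega>))"
    unfolding AE_all_countable using * by (auto intro: AE_I2)
  then show ?thesis
  proof eventually_elim
    case (elim \<omega>)
    show ?case unfolding frequently_sequentially
    proof
      fix N
      obtain n where "n \<ge> max N N\<^sub>0" "threshold CARD('d) n < coord_sum (X n \<omega>)"
        using elim by (meson max.cobounded2)
      then show "\<exists>n\<ge>N. threshold CARD('d) n < coord_sum (X n \<omega>)" by auto
    qed
  qed
qed

section \<open>The width divided by ln ln n\<close>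

abbreviation width_ratio :: "nat \<Rightarrow> 'a \<Rightarrow> real" where
  "width_ratio n \<omega> \<equiv> frontier_width (sample \<omega>) n / ln (ln (real n))"

lemma eventually_ln_ln_pos: "\<forall>\<^sub>F n in sequentially. 0 < ln (ln (real n))"
  by real_asymp

lemma width_deviation_event:
  "{\<omega> \<in> space M. \<bar>width_ratio n \<omega> - c\<bar> > e} \<in> events"
proof -
  note [measurable] = frontier_width_measurable
  show ?thesis by measurable
qed

text \<open>A deviation beyond \<open>e\<close> forces the maximum or the minimum to miss its target
  by more than \<open>e / 2\<close> times \<open>ln (ln n)\<close> on one side, and each of these
  four events has vanishing probability.\<close>

lemma width_ratio_in_probability:
  assumes e: "e > 0"
  shows "(\<lambda>n. prob {\<omega> \<in> space M. \<bar>width_ratio n \<omega> - (real CARD('d) - 1)\<bar> > e}) \<longlonglongrightarrow> 0"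
proof (rule Lim_null_comparison)
  define d where "d = real CARD('d) - 1"
  let ?A = "\<lambda>n. {\<omega> \<in> space M. threshold (d + e / 2) n < sum_max (sample \<omega>) n}"
  let ?B = "\<lambda>n. {\<omega> \<in> space M. sum_max (sample \<omega>) n < threshold (d - e / 2) n}"
  let ?C = "\<lambda>n. {\<omega> \<in> space M. threshold (e / 2) n < region_min (sample \<omega>) n}"
  let ?D = "\<lambda>n. {\<omega> \<in> space M. region_min (sample \<omega>) n < threshold (- (e / 2)) n}"
  show "\<forall>\<^sub>F n in sequentially. norm (prob {\<omega> \<in> space M. \<bar>width_ratio n \<omega> - (real CARD('d) - 1)\<bar> > e})
      \<le> prob (?A n) + prob (?B n) + (prob (?C n) + prob (?D n))"
    using eventually_ln_ln_pos eventually_ge_at_top[of 1]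
  proof eventually_elim
    case (elim n)
    let ?L = "ln (ln (real n))"
    have "prob {\<omega> \<in> space M. \<bar>width_ratio n \<omega> - d\<bar> > e} \<le> prob ((?A n \<union> ?B n) \<union> (?C n \<union> ?D n))"
    proof (rule finite_measure_mono_AE)
      show "AE \<omega> in M. \<omega> \<in> {\<omega> \<in> space M. \<bar>width_ratio n \<omega> - d\<bar> > e} \<longrightarrow> \<omega> \<in> (?A n \<union> ?B n) \<union> (?C n \<union> ?D n)"
        using AE_frontier_width
      proof eventually_elim
        case (elim \<omega>)
        let ?S = "sum_max (sample \<omega>) n" and ?R = "region_min (sample \<omega>) n"
        have W: "width_ratio n \<omega> = (?S - ?R) / ?L" using elim \<open>1 \<le> n\<close> by simp
        show ?case
        proof (intro impI, rule ccontr)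
          assume dev: "\<omega> \<in> {\<omega> \<in> space M. \<bar>width_ratio n \<omega> - d\<bar> > e}"
            and "\<omega> \<notin> (?A n \<union> ?B n) \<union> (?C n \<union> ?D n)"
          then have "?S \<le> threshold (d + e / 2) n" "threshold (d - e / 2) n \<le> ?S"
            "?R \<le> threshold (e / 2) n" "threshold (- (e / 2)) n \<le> ?R" by auto
          then have "?S - ?R \<le> (d + e) * ?L" "(d - e) * ?L \<le> ?S - ?R"
            by (auto simp: algebra_simps)
          then have "(?S - ?R) / ?L \<le> d + e" "d - e \<le> (?S - ?R) / ?L"
            using \<open>0 < ?L\<close> by (simp_all add: pos_divide_le_eq pos_le_divide_eq)
          with dev W show False by auto
        qed
      qed
    qed measurable
    also have "\<dots> \<le> prob (?A n \<union> ?B n) + prob (?C n \<union> ?D n)"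
      by (rule measure_Un_le) measurable
    also have "\<dots> \<le> prob (?A n) + prob (?B n) + (prob (?C n) + prob (?D n))"
      by (intro add_mono measure_Un_le) measurable
    finally show ?case by (simp add: d_def)
  qed
  have "(\<lambda>n. prob (?A n) + prob (?B n) + (prob (?C n) + prob (?D n))) \<longlonglongrightarrow> 0 + 0 + (0 + 0)"
  proof (intro tendsto_add)
    show "(\<lambda>n. prob (?A n)) \<longlonglongrightarrow> 0"
      by (rule prob_tendsto_0_of_bigo[OF sum_max_upper_tail]) (use e in \<open>simp add: d_def\<close>)
    show "(\<lambda>n. prob (?B n)) \<longlonglongrightarrow> 0"
      by (rule prob_tendsto_0_of_bigo[OF sum_max_lower_tail]) (use e in \<open>simp_all add: d_def\<close>)
    show "(\<lambda>n. prob (?C n)) \<longlonglongrightarrow> 0"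
      \<comment> \<open>One test point is enough here, since any positive exponent gives convergence
        to 0; thus dimension one is included.\<close>
      by (rule prob_tendsto_0_of_bigo[OF region_min_upper_tail[of 1]]) (use e in simp_all)
    show "(\<lambda>n. prob (?D n)) \<longlonglongrightarrow> 0"
      by (rule prob_tendsto_0_of_bigo[OF region_min_lower_tail]) (use e in simp_all)
  qed
  then show "(\<lambda>n. prob (?A n) + prob (?B n) + (prob (?C n) + prob (?D n))) \<longlonglongrightarrow> 0" by simp
qed

text \<open>The two eventual bounds subtract the almost sure bounds for maximum and minimum. Values
  near \<open>d - 1\<close> recur by convergence in probability, and values near \<open>d\<close>
  recur because single sample points exceed \<open>threshold d n\<close> infinitely often while the
  minimum stays near \<open>ln n\<close>.\<close>

lemma AE_width_ratio:
  assumes d: "CARD('d) \<ge> 2" and e: "e > 0"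
  shows "AE \<omega> in M. (\<forall>\<^sub>F n in sequentially. real CARD('d) - 1 - e \<le> width_ratio n \<omega>) \<and>
     (\<exists>\<^sub>F n in sequentially. width_ratio n \<omega> \<le> real CARD('d) - 1 + e) \<and>
     (\<forall>\<^sub>F n in sequentially. width_ratio n \<omega> \<le> real CARD('d) + e) \<and>
     (\<exists>\<^sub>F n in sequentially. real CARD('d) - e \<le> width_ratio n \<omega>)"
proof -
  define D where "D = real CARD('d)"
  have e2: "e / 2 > 0" using e by simp
  have "AE \<omega> in M. \<exists>\<^sub>F n in sequentially. \<omega> \<notin> {\<omega> \<in> space M. \<bar>width_ratio n \<omega> - (D - 1)\<bar> > e}"
    unfolding D_def
    by (rule AE_frequently_not_of_prob_tendsto_0[OF width_deviation_event width_ratio_in_probability[OF e]])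
  moreover have "AE \<omega> in M. \<forall>\<^sub>F n in sequentially. sum_max (sample \<omega>) n \<le> threshold (D + e / 2) n"
    using e by (intro AE_sum_max_upper) (simp add: D_def)
  moreover have "AE \<omega> in M. \<forall>\<^sub>F n in sequentially. threshold (D - 1 - e / 2) n \<le> sum_max (sample \<omega>) n"
    using e by (intro AE_sum_max_lower) (simp add: D_def)
  moreover note AE_region_min_upper[OF d e2] AE_region_min_lower[OF e2]
    AE_frequently_coord_sum_gt AE_frontier_width AE_space
  ultimately show ?thesis
  proof eventually_elim
    case (elim \<omega>)
    let ?S = "\<lambda>n. sum_max (sample \<omega>) n" and ?R = "\<lambda>n. region_min (sample \<omega>) n"
    let ?L = "\<lambda>n. ln (ln (real n))"
    have W: "\<forall>\<^sub>F n in sequentially. width_ratio n \<omega> = (?S n - ?R n) / ?L n"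
      using elim(7) by (auto simp: eventually_sequentially)
    have lower: "\<forall>\<^sub>F n in sequentially. D - 1 - e \<le> width_ratio n \<omega>"
      using W elim(3,4) eventually_ln_ln_pos
    proof eventually_elim
      case (elim n)
      then have "(D - 1 - e) * ?L n \<le> ?S n - ?R n" by (simp add: algebra_simps)
      with elim show ?case by (simp add: pos_le_divide_eq)
    qed
    have upper: "\<forall>\<^sub>F n in sequentially. width_ratio n \<omega> \<le> D + e"
      using W elim(2,5) eventually_ln_ln_pos
    proof eventually_elim
      case (elim n)
      then have "?S n - ?R n \<le> (D + e) * ?L n" by (simp add: algebra_simps)
      with elim show ?case by (simp add: pos_divide_le_eq)
    qed
    have freq_low: "\<exists>\<^sub>F n in sequentially. width_ratio n \<omega> \<le> D - 1 + e"
      using elim(1,8) by (auto elim!: frequently_elim1)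
    have "\<forall>\<^sub>F n in sequentially. threshold D n < coord_sum (X n \<omega>) \<longrightarrow> D - e \<le> width_ratio n \<omega>"
      using W elim(4) eventually_ln_ln_pos eventually_ge_at_top[of 1]
    proof eventually_elim
      case (elim n)
      show ?case
      proof
        assume *: "threshold D n < coord_sum (X n \<omega>)"
        have "coord_sum (X n \<omega>) \<le> ?S n"
          using sum_max_le_iff[of n "sample \<omega>" "?S n"] elim by auto
        moreover have "0 \<le> e / 2 * ?L n" using e elim by simp
        ultimately have "(D - e) * ?L n \<le> ?S n - ?R n"
          using * elim by (simp add: algebra_simps)
        with elim show "D - e \<le> width_ratio n \<omega>" by (simp add: pos_le_divide_eq)
      qed
    qed
    moreover have "\<exists>\<^sub>F n in sequentially. threshold D n < coord_sum (X n \<omega>)"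
      using elim(6) by (simp add: D_def)
    ultimately have "\<exists>\<^sub>F n in sequentially. D - e \<le> width_ratio n \<omega>"
      by (rule frequently_rev_mp[rotated])
    with lower upper freq_low show ?case by (simp add: D_def)
  qed
qed

text \<open>All four conditions weaken as \<open>e\<close> grows, so the countably many values
  \<open>1 / (q + 1)\<close> give one null set for every \<open>e\<close>.\<close>

lemma AE_width_ratio_all:
  assumes d: "CARD('d) \<ge> 2"
  shows "AE \<omega> in M. \<forall>e>0. (\<forall>\<^sub>F n in sequentially. real CARD('d) - 1 - e \<le> width_ratio n \<omega>) \<and>
     (\<exists>\<^sub>F n in sequentially. width_ratio n \<omega> \<le> real CARD('d) - 1 + e) \<and>
     (\<forall>\<^sub>F n in sequentially. width_ratio n \<omega> \<le> real CARD('d) + e) \<and>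
     (\<exists>\<^sub>F n in sequentially. real CARD('d) - e \<le> width_ratio n \<omega>)"
    (is "AE \<omega> in M. \<forall>e>0. ?P \<omega> e")
proof -
  have mono: "?P \<omega> e" if P: "?P \<omega> e'" and "e' < e" for \<omega> e e'
  proof (intro conjI)
    show "\<forall>\<^sub>F n in sequentially. real CARD('d) - 1 - e \<le> width_ratio n \<omega>"
      by (rule eventually_mono[OF P[THEN conjunct1]]) (use that(2) in linarith)
    show "\<exists>\<^sub>F n in sequentially. width_ratio n \<omega> \<le> real CARD('d) - 1 + e"
      by (rule frequently_elim1[OF P[THEN conjunct2, THEN conjunct1]]) (use that(2) in linarith)
    show "\<forall>\<^sub>F n in sequentially. width_ratio n \<omega> \<le> real CARD('d) + e"
      by (rule eventually_mono[OF P[THEN conjunct2, THEN conjunct2, THEN conjunct1]]) (use that(2) in linarith)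
    show "\<exists>\<^sub>F n in sequentially. real CARD('d) - e \<le> width_ratio n \<omega>"
      by (rule frequently_elim1[OF P[THEN conjunct2, THEN conjunct2, THEN conjunct2]]) (use that(2) in linarith)
  qed
  have "AE \<omega> in M. \<forall>q::nat. ?P \<omega> (inverse (real (Suc q)))"
    unfolding AE_all_countable by (intro allI AE_width_ratio[OF d]) simp
  then show ?thesis
  proof eventually_elim
    case (elim \<omega>)
    show ?case
    proof (intro allI impI)
      fix e :: real assume "e > 0"
      then obtain q where "inverse (real (Suc q)) < e" using reals_Archimedean by blast
      with elim mono show "?P \<omega> e" by blast
    qed
  qed
qed

lemma AE_liminf_limsup_width_ratio:
  assumes "CARD('d) \<ge> 2"
  shows "AE \<omega> in M. liminf (\<lambda>n. ereal (width_ratio n \<omega>)) = ereal (real CARD('d) - 1) \<and>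
      limsup (\<lambda>n. ereal (width_ratio n \<omega>)) = ereal (real CARD('d))"
  using AE_width_ratio_all[OF assms]
proof eventually_elim
  case (elim \<omega>)
  show ?case
    by (intro conjI Liminf_eqI_frequently Limsup_eqI_frequently) (use elim in blast)+
qed

lemma AE_width_bigtheta:
  assumes d: "CARD('d) \<ge> 2"
  shows "AE \<omega> in M. (\<lambda>n. frontier_width (sample \<omega>) n) \<in> \<Theta>(\<lambda>n. ln (ln (real n)))"
  using AE_width_ratio_all[OF assms]
proof eventually_elim
  case (elim \<omega>)
  have "\<forall>\<^sub>F n in sequentially. real CARD('d) - 1 - 1/2 \<le> width_ratio n \<omega>"
    using elim[rule_format, of "1/2"] by simp
  moreover have "\<forall>\<^sub>F n in sequentially. width_ratio n \<omega> \<le> real CARD('d) + 1/2"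
    using elim[rule_format, of "1/2"] by simp
  ultimately have bounds: "\<forall>\<^sub>F n in sequentially. 1/2 * ln (ln (real n)) \<le> frontier_width (sample \<omega>) n \<and>
      frontier_width (sample \<omega>) n \<le> (real CARD('d) + 1/2) * ln (ln (real n)) \<and> 0 < ln (ln (real n))"
    using eventually_ln_ln_pos
  proof eventually_elim
    case (elim n)
    \<comment> \<open>With tolerance \<open>1/2\<close> the lower bound is \<open>d - 3/2\<close>,
      at least \<open>1/2\<close> for \<open>d\<close> at least 2.\<close>
    have "1/2 \<le> width_ratio n \<omega>" using elim(1) d by linarith
    with elim show ?case by (simp add: pos_le_divide_eq pos_divide_le_eq)
  qed
  show ?case
  proof (rule bigthetaI)
    show "(\<lambda>n. frontier_width (sample \<omega>) n) \<in> O(\<lambda>n. ln (ln (real n)))"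
      by (rule landau_o.bigI[of "real CARD('d) + 1/2"])
         (use bounds in \<open>auto elim!: eventually_mono\<close>)
    show "(\<lambda>n. frontier_width (sample \<omega>) n) \<in> \<Omega>(\<lambda>n. ln (ln (real n)))"
      by (rule landau_omega.bigI[of "1/2"])
         (use bounds in \<open>auto elim!: eventually_mono\<close>)
  qed
qed

end

text \<open>Measurability of each \<open>W n\<close> is part of the conclusion because
  \<open>measure\<close> is 0 on sets that are not measurable, which could otherwise make the
  convergence claim empty.\<close>

theorem theorem1p11:
  fixes M :: "'a measure" and X :: "nat \<Rightarrow> 'a \<Rightarrow> real^'d"
  assumes "prob_space M"
    and meas: "\<And>i. i \<ge> 1 \<Longrightarrow> X i \<in> borel_measurable M"
    and indep: "prob_space.indep_vars M (\<lambda>_. borel) X {1..}"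
    and coord_indep: "\<And>i. i \<ge> 1 \<Longrightarrow>
          prob_space.indep_vars M (\<lambda>_. borel) (\<lambda>j \<omega>. X i \<omega> $ j) UNIV"
    and coord_exp: "\<And>i j. i \<ge> 1 \<Longrightarrow>
          distributed M lborel (\<lambda>\<omega>. X i \<omega> $ j) (exponential_density 1)"
  defines "W \<equiv> \<lambda>n \<omega>. frontier_width (\<lambda>i. X i \<omega>) n"
  shows "(\<forall>n. W n \<in> borel_measurable M) \<and>
         (\<forall>\<epsilon>>0. (\<lambda>n. measure M {\<omega> \<in> space M.
               \<bar>W n \<omega> / ln (ln (real n)) - (real CARD('d) - 1)\<bar> > \<epsilon>}) \<longlonglongrightarrow> 0) \<and>
         (CARD('d) \<ge> 2 \<longrightarrow>
            (AE \<omega> in M.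
               liminf (\<lambda>n. ereal (W n \<omega> / ln (ln (real n)))) = ereal (real CARD('d) - 1) \<and>
               limsup (\<lambda>n. ereal (W n \<omega> / ln (ln (real n)))) = ereal (real CARD('d))) \<and>
            (AE \<omega> in M. (\<lambda>n. W n \<omega>) \<in> \<Theta>(\<lambda>n. ln (ln (real n)))))"
proof -
  interpret prob_space M by fact
  interpret exponential_sample M X
    by unfold_locales (fact meas indep coord_indep coord_exp)+
  show ?thesis
    unfolding W_def
    using frontier_width_measurable width_ratio_in_probability
      AE_liminf_limsup_width_ratio AE_width_bigtheta by blast
qed

end
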